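(* For almost all $\theta\in(0,1)$ (for the Lebesgue measure), the spectral triple $(C_\infty(X^\theta),L^2(X^\theta,\mu),D_{X^\theta})$ has finite Connes metric, and the topology induced by the Connes metric on the state space of $C(X^\theta)$ is the weak-$*$ topology. Here, for irrational $\theta$, $X^\theta$ is the Sturmian subshift of parameter $\theta$ and $\mu$ is its unique invariant probability measure.
   Context: Sturmian subshifts. For irrational $0<\theta<1$, $X^\theta\subseteq\{0,1\}^{\mathbb{Z}}$ is the set of all sequences $w=(w_n)_{n\in\mathbb{Z}}$ such that, for some real number $x$ and for $I$ either $[0,1-\theta)$ or $(0,1-\theta]$, one has for all $n$: $w_n=0$ if $\{n\theta-x\}\in I$ and $w_n=1$ otherwise, where $\{y\}=y-\lfloor y\rfloor$. With the left shift $\sigma(x)_n=x_{n+1}$, $X^\theta$ is a minimal, uniquely ergodic subshift (well known); its unique invariant probability measure $\mu$ has support $X^\theta$. Spectral triple. Let $X=X^\theta$. For $n\ge1$, $X_n=\{(x_1,\dots,x_n):x\in X\}$. For $w\in X_n$, $U(w)=\{x\in X:(x_{-m},\dots,x_m)=w\}$ if $n=2m+1$, and $U(w)=\{x\in X:(x_{1-m},\dots,x_m)=w\}$ if $n=2m\ge2$; $\xi(w)$ is the characteristic function of $U(w)$. Set $C_{-1}=\{0\}$, $C_0=\mathbb{C}1$, $C_n=\mathrm{span}\{\xi(w):w\in X_n\}$ for $n\ge1$, viewed both in $C(X)$ and in $L^2(X,\mu)$; $C_\infty(X)=\bigcup_nC_n$, acting on $L^2(X,\mu)$ by multiplication. $D_X$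 is the operator on $L^2(X,\mu)$ with domain $\{\sum_{n\ge0}\xi_n:\xi_n\in C_n\cap C_{n-1}^\perp,\ \sum_n(n\|\xi_n\|)^2<\infty\}$ and $D_X\xi=n\xi$ for $\xi\in C_n\cap C_{n-1}^\perp$, $n\ge0$. For every $f\in C_\infty(X)$, $[D_X,f]$ extends to a bounded operator, whose norm is denoted $\|[D_X,f]\|$. Connes metric. On the state space of $C(X)$, $d(\phi,\psi)=\sup\{|\phi(f)-\psi(f)|: f\in C_\infty(X),\ \|[D_X,f]\|\le1\}\in[0,\infty]$. It is called finite if $d(\phi,\psi)<\infty$ for all states $\phi,\psi$. *)

theory Defs
  imports "HOL-Analysis.Analysis"
begin

section \<open>Sturmian subshifts\<close>

text \<open>Bi-infinite words are functions \<^typ>\<open>int \<Rightarrow> nat\<close>, with the product topology of the discrete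
  topology on \<^typ>\<open>nat\<close> (the topology of the library on function types).\<close>

type_synonym biword = "int \<Rightarrow> nat"

definition sturmian :: "real \<Rightarrow> biword set" where
  "sturmian \<theta> = {w. \<exists>x::real. \<exists>I \<in> {{0..<1-\<theta>}, {0<..1-\<theta>}}.
     \<forall>n. w n = (if frac (of_int n * \<theta> - x) \<in> I then 0 else 1)}"

definition shift :: "biword \<Rightarrow> biword" where
  "shift x = (\<lambda>n. x (n + 1))"

definition invariant_prob :: "biword set \<Rightarrow> biword measure \<Rightarrow> bool" where
  "invariant_prob X \<mu> \<longleftrightarrow> space \<mu> = X \<and> sets \<mu> = sets (restrict_space borel X) \<and>
     emeasure \<mu> X = 1 \<and> shift \<in> measurable \<mu> \<mu> \<and> distr \<mu> \<mu> shift = \<mu>"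


section \<open>Locally constant functions\<close>

definition words :: "biword set \<Rightarrow> nat \<Rightarrow> nat list set" where
  "words X n = {map x [1..int n] | x. x \<in> X}"

definition window :: "nat \<Rightarrow> int list" where
  "window n = (if odd n then [- int (n div 2)..int (n div 2)]
                        else [1 - int (n div 2)..int (n div 2)])"

definition cyl :: "biword set \<Rightarrow> nat list \<Rightarrow> biword set" where
  "cyl X w = {x \<in> X. map x (window (length w)) = w}"

text \<open>A function on \<open>X\<close> is represented by its extension by \<open>0\<close> to the type \<^typ>\<open>biword\<close>; the unit
  of \<open>C(X)\<close> is therefore \<open>indicator X\<close>.\<close>

definition CX :: "biword set \<Rightarrow> (biword \<Rightarrow> complex) set" where
  "CX X = {f. continuous_on X f \<and> (\<forall>x. x \<notin> X \<longrightarrow> f x = 0)}"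

definition Cn :: "biword set \<Rightarrow> nat \<Rightarrow> (biword \<Rightarrow> complex) set" where
  "Cn X n = (if n = 0 then {(\<lambda>x. a * indicator X x) | a. True}
             else {(\<lambda>x. \<Sum>w \<in> words X n. a w * indicator (cyl X w) x) | a. True})"

definition Cinf :: "biword set \<Rightarrow> (biword \<Rightarrow> complex) set" where
  "Cinf X = (\<Union>n. Cn X n)"


section \<open>The Hilbert space and the Dirac operator\<close>

text \<open>Elements of \<open>L\<^sup>2\<close> are represented by square-integrable functions. Everything below depends
  only on their classes modulo equality almost everywhere.\<close>

definition L2 :: "'a measure \<Rightarrow> ('a \<Rightarrow> complex) set" where
  "L2 \<mu> = {\<xi>. \<xi> \<in> borel_measurable \<mu> \<and> integrable \<mu> (\<lambda>x. (cmod (\<xi> x))\<^sup>2)}"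

definition l2inner :: "'a measure \<Rightarrow> ('a \<Rightarrow> complex) \<Rightarrow> ('a \<Rightarrow> complex) \<Rightarrow> complex" where
  "l2inner \<mu> \<xi> \<eta> = (\<integral>x. \<xi> x * cnj (\<eta> x) \<partial>\<mu>)"

definition l2norm :: "'a measure \<Rightarrow> ('a \<Rightarrow> complex) \<Rightarrow> real" where
  "l2norm \<mu> \<xi> = sqrt (\<integral>x. (cmod (\<xi> x))\<^sup>2 \<partial>\<mu>)"

text \<open>\<open>C\<^sub>n \<inter> C\<^bsub>n-1\<^esub>\<^sup>\<bottom>\<close>; for \<open>n = 0\<close> there is no condition, as \<open>C\<^bsub>-1\<^esub> = {0}\<close>.\<close>

definition eigenspace :: "biword set \<Rightarrow> biword measure \<Rightarrow> nat \<Rightarrow> (biword \<Rightarrow> complex) set" where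
  "eigenspace X \<mu> n = {\<xi> \<in> Cn X n. n > 0 \<longrightarrow> (\<forall>\<eta> \<in> Cn X (n - 1). l2inner \<mu> \<xi> \<eta> = 0)}"

text \<open>The graph of the unbounded operator \<open>D\<^sub>X\<close>: \<open>\<xi>\<close> is in its domain, and \<open>D\<^sub>X \<xi> = \<eta>\<close>
  (in \<open>L\<^sup>2\<close>). Both series are required to converge in norm.\<close>

definition dirac :: "biword set \<Rightarrow> biword measure \<Rightarrow> (biword \<Rightarrow> complex) \<Rightarrow> (biword \<Rightarrow> complex) \<Rightarrow> bool"
  where
  "dirac X \<mu> \<xi> \<eta> \<longleftrightarrow> \<xi> \<in> L2 \<mu> \<and> \<eta> \<in> L2 \<mu> \<and>
     (\<exists>c. (\<forall>n. c n \<in> eigenspace X \<mu> n) \<and>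
          summable (\<lambda>n. (real n * l2norm \<mu> (c n))\<^sup>2) \<and>
          (\<lambda>N. l2norm \<mu> (\<lambda>x. \<xi> x - (\<Sum>n<N. c n x))) \<longlonglongrightarrow> 0 \<and>
          (\<lambda>N. l2norm \<mu> (\<lambda>x. \<eta> x - (\<Sum>n<N. of_nat n * c n x))) \<longlonglongrightarrow> 0)"

text \<open>The norm of \<open>[D\<^sub>X, f]\<close>, an operator with domain \<open>{\<xi>. \<xi> \<in> dom D\<^sub>X \<and> f\<xi> \<in> dom D\<^sub>X}\<close>; it is
  \<open>\<infinity>\<close> if the commutator is unbounded.\<close>

definition commutator_norm :: "biword set \<Rightarrow> biword measure \<Rightarrow> (biword \<Rightarrow> complex) \<Rightarrow> ennreal" where
  "commutator_norm X \<mu> f =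
     Sup {ennreal (l2norm \<mu> (\<lambda>x. \<zeta> x - f x * \<eta> x)) | \<xi> \<eta> \<zeta>.
       dirac X \<mu> \<xi> \<eta> \<and> dirac X \<mu> (\<lambda>x. f x * \<xi> x) \<zeta> \<and> l2norm \<mu> \<xi> \<le> 1}"


section \<open>States and the Connes metric\<close>

text \<open>States are extensional, i.e. \<open>undefined\<close> outside \<open>C(X)\<close>, so that equal states are equal
  as HOL functions.\<close>

definition states :: "biword set \<Rightarrow> ((biword \<Rightarrow> complex) \<Rightarrow> complex) set" where
  "states X = {\<phi> \<in> extensional (CX X).
     (\<forall>f \<in> CX X. \<forall>g \<in> CX X. \<phi> (\<lambda>x. f x + g x) = \<phi> f + \<phi> g) \<and>
     (\<forall>f \<in> CX X. \<forall>a. \<phi> (\<lambda>x. a * f x) = a * \<phi> f) \<and>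
     (\<forall>f \<in> CX X. (\<forall>x. f x \<in> \<real>\<^sub>\<ge>\<^sub>0) \<longrightarrow> \<phi> f \<in> \<real>\<^sub>\<ge>\<^sub>0) \<and>
     \<phi> (indicator X) = 1}"

definition weak_star :: "biword set \<Rightarrow> ((biword \<Rightarrow> complex) \<Rightarrow> complex) topology" where
  "weak_star X = subtopology (product_topology (\<lambda>_. euclidean) (CX X)) (states X)"

definition connes_dist :: "biword set \<Rightarrow> biword measure \<Rightarrow> ((biword \<Rightarrow> complex) \<Rightarrow> complex) \<Rightarrow>
    ((biword \<Rightarrow> complex) \<Rightarrow> complex) \<Rightarrow> ennreal" where
  "connes_dist X \<mu> \<phi> \<psi> =
     (SUP f \<in> {f \<in> Cinf X. commutator_norm X \<mu> f \<le> 1}. ennreal (cmod (\<phi> f - \<psi> f)))"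

definition finite_connes_metric :: "biword set \<Rightarrow> biword measure \<Rightarrow> bool" where
  "finite_connes_metric X \<mu> \<longleftrightarrow> (\<forall>\<phi> \<in> states X. \<forall>\<psi> \<in> states X. connes_dist X \<mu> \<phi> \<psi> < \<infinity>)"

text \<open>The topology of the Connes metric: a set of states is open if it contains a ball about each of its points. As the
  metric may be infinite, it is not directly an instance of the library's metric spaces.\<close>

definition connes_topology :: "biword set \<Rightarrow> biword measure \<Rightarrow>
    ((biword \<Rightarrow> complex) \<Rightarrow> complex) topology" where
  "connes_topology X \<mu> = topology (\<lambda>U. U \<subseteq> states X \<and>
     (\<forall>\<phi> \<in> U. \<exists>r>0. \<forall>\<psi> \<in> states X. connes_dist X \<mu> \<phi> \<psi> < r \<longrightarrow> \<psi> \<in> U))"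

end

theory Submission
  imports Defs
begin

text \<open>
  The Connes metric induces the weak-* topology if the functions \<open>f\<close> with commutator norm at most one
  are bounded modulo constants, and if all of them are, up to an arbitrarily small uniform error,
  functions of one central block of bounded length: then finitely many cylinder functions control
  them all. That the Connes topology is at least as fine as the weak-* topology only uses that the
  commutators of locally constant functions are bounded (\<open>commutator_norm_Cn\<close>) and that these functions
  are dense (\<open>Cinf_dense\<close>).

  Uniform approximation comes from two estimates. The constant function \<open>1\<close> lies in the kernel of the
  Dirac operator \<open>D\<close>, so the commutator of \<open>D\<close> and \<open>f\<close> maps it to \<open>D f\<close>. If the commutator has norm at
  most one, \<open>f\<close> therefore differs from its orthogonal projection \<open>P\<^sub>N f\<close> to \<open>C\<^sub>N\<close> by at most \<open>1/N\<close> in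
  \<open>L\<^sup>2\<close> (\<open>commutator_le_1_average\<close>). On the other hand, a function in \<open>C\<^sub>n\<close> is constant on cylinders of
  length \<open>n\<close>; its sup norm is at most its norm in \<open>L\<^sup>2\<close> divided by the square root of the smallest
  measure of a cylinder (\<open>sup_le_sqnorm\<close>). If cylinders of length \<open>n\<close> have measure at least
  \<open>C * n powr (-s)\<close>, then the passage from \<open>P\<^sub>N f\<close> to \<open>P\<^bsub>2N\<^esub> f\<close> changes \<open>f\<close> uniformly by at most a
  multiple of \<open>N powr (s/2 - 1)\<close>. For \<open>s < 2\<close> this is summable over the powers \<open>N\<close> of two
  (\<open>uniform_approximation\<close>). The locale \<open>polynomial_subshift\<close> derives the conclusion for every
  subshift with such a bound.

  For Sturmian subshifts the bound with \<open>s = 25/16\<close> follows from recurrence (\<open>sturmian_measure_lower\<close>).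
  Almost every \<open>\<theta>\<close> satisfies \<open>\<bar>k\<theta> - m\<bar> \<ge> c * k powr (-5/4)\<close>, by the Borel-Cantelli lemma. Hence blocks of
  length \<open>n\<close> correspond to intervals of parameters of length at least a multiple of
  \<open>n powr (-5/4)\<close> (\<open>block_interval\<close>). A rational approximation \<open>p/q\<close> of \<open>\<theta>\<close> shows that \<open>q\<close> steps of
  the rotation hit every interval of length \<open>4/q\<close> (\<open>orbit_dense\<close>), and the same diophantine condition
  yields suitable denominators \<open>q\<close> of order at most \<open>n powr (25/16)\<close>. If every orbit visits a set within
  \<open>q\<close> steps, then every invariant probability measure gives it at least the mass \<open>1/q\<close>
  (\<open>measure_recurrent\<close>). Instead of \<open>5/4\<close> any exponent above \<open>1\<close> whose square is less than \<open>2\<close> would do.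
\<close>

section \<open>Subshifts and locally constant functions\<close>

lemma length_window [simp]: "length (window n) = n"
  by (cases "odd n") (auto simp: window_def elim!: oddE evenE)

lemma window_shift: "window n = map (\<lambda>i. i - int ((n + 1) div 2)) [1..int n]"
proof (rule nth_equalityI)
  fix i assume "i < length (window n)"
  then show "window n ! i = map (\<lambda>i. i - int ((n + 1) div 2)) [1..int n] ! i"
    by (cases "odd n") (auto simp: window_def nth_upto elim!: oddE evenE)
qed simp

lemma window_mono: "n \<le> m \<Longrightarrow> set (window n) \<subseteq> set (window m)"
proof (induction rule: dec_induct)
  case (step m)
  have "set (window m) \<subseteq> set (window (Suc m))"
    by (cases "odd m") (auto simp: window_def elim!: oddE evenE)
  with step show ?case by blast
qed simp

lemma in_window: "2 * \<bar>i\<bar> < int n \<Longrightarrow> i \<in> set (window n)"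
  by (cases "odd n") (auto simp: window_def elim!: oddE evenE)

definition same :: "nat \<Rightarrow> biword \<Rightarrow> biword \<Rightarrow> bool" where
  "same n x y \<longleftrightarrow> (\<forall>i\<in>set (window n). x i = y i)"

lemma same_refl [simp]: "same n x x" by (simp add: same_def)

lemma same_mono: "same m x y \<Longrightarrow> n \<le> m \<Longrightarrow> same n x y"
  using window_mono by (auto simp: same_def)

lemma same_iff: "same n x y \<longleftrightarrow> map x (window n) = map y (window n)"
  by (simp add: same_def)

lemma shift_funpow: "(shift ^^ k) x = (\<lambda>n. x (n + int k))"
  by (induction k arbitrary: x) (auto simp: shift_def funpow_Suc_right algebra_simps simp del: funpow.simps)

lemma tendsto_biword_iff:
  fixes x :: biword
  shows "(w \<longlongrightarrow> x) F \<longleftrightarrow> (\<forall>i. \<forall>\<^sub>F k in F. w k i = x i)"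
proof -
  have "(w \<longlongrightarrow> x) F \<longleftrightarrow> limitin (product_topology (\<lambda>i. euclidean) UNIV) w x F"
    by (simp add: euclidean_product_topology limitin_canonical_iff)
  also have "\<dots> \<longleftrightarrow> (\<forall>i. ((\<lambda>k. w k i) \<longlongrightarrow> x i) F)"
    by (simp add: limitin_componentwise limitin_canonical_iff)
  finally show ?thesis by (simp add: tendsto_discrete)
qed

locale subshift =
  fixes X :: "biword set"
  assumes compact_X: "compact X" and shift_X: "shift ` X = X" and ne_X: "X \<noteq> {}"
begin

lemma finite_letters: "finite ((\<lambda>x. x i) ` X)"
proof -
  have "compact ((\<lambda>x. x i) ` X)"
    by (rule compact_continuous_image[OF continuous_on_product_then_coordinatewise compact_X]) simp
  then obtain C where "C \<subseteq> range (\<lambda>n::nat. {n})" "finite C" "(\<lambda>x. x i) ` X \<subseteq> \<Union> C"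
    by (rule compactE[of _ "range (\<lambda>n::nat. {n})"]) (auto simp: open_discrete)
  then have "finite (\<Union> C)" by (intro finite_Union) auto
  then show ?thesis by (rule finite_subset[OF \<open>(\<lambda>x. x i) ` X \<subseteq> \<Union> C\<close>])
qed

lemma finite_words: "finite (words X n)"
proof (rule finite_subset)
  let ?A = "\<Union>i\<in>{1..int n}. (\<lambda>x. x i) ` X"
  show "words X n \<subseteq> {w. set w \<subseteq> ?A \<and> length w = n}"
    by (fastforce simp: words_def)
  show "finite {w. set w \<subseteq> ?A \<and> length w = n}"
    using finite_letters by (intro finite_lists_length_eq) blast
qed

lemma shift_power_X: "(shift ^^ k) ` X = X"
proof (induction k)
  case (Suc k)
  have "(shift ^^ Suc k) ` X = shift ` (shift ^^ k) ` X" by (simp add: image_comp o_def)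
  with Suc show ?case by (simp add: shift_X)
qed simp

text \<open>Words are read at the positions \<open>1, \<dots>, n\<close>, cylinders at a window around \<open>0\<close>. Both see the same
  blocks because \<open>X\<close> is invariant under the shift.\<close>

lemma words_window: "words X n = (\<lambda>x. map x (window n)) ` X"
proof -
  let ?s = "(n + 1) div 2"
  have "map ((shift ^^ ?s) x) (window n) = map x [1..int n]" for x
    by (simp add: shift_funpow window_shift)
  then have "words X n = (\<lambda>x. map x (window n)) ` (shift ^^ ?s) ` X"
    by (auto simp: words_def image_image setcompr_eq_image)
  then show ?thesis by (simp add: shift_power_X)
qed

lemma length_words: "w \<in> words X n \<Longrightarrow> length w = n"
  by (auto simp: words_def)

lemma word_in: "x \<in> X \<Longrightarrow> map x (window n) \<in> words X n"
  by (auto simp: words_window)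

lemma cyl_map_window: "cyl X (map x (window n)) = {y \<in> X. same n x y}"
  by (auto simp: cyl_def same_def)

lemma in_cyl_iff: "w \<in> words X n \<Longrightarrow> x \<in> X \<Longrightarrow> x \<in> cyl X w \<longleftrightarrow> w = map x (window n)"
  using length_words by (auto simp: cyl_def)

lemma sum_words_indicator:
  fixes a :: "nat list \<Rightarrow> complex"
  shows "(\<Sum>w\<in>words X n. a w * indicator (cyl X w) x) = (if x \<in> X then a (map x (window n)) else 0)"
proof (cases "x \<in> X")
  case True
  have "(\<Sum>w\<in>words X n. a w * indicator (cyl X w) x)
      = (\<Sum>w\<in>words X n. if w = map x (window n) then a w else 0)"
    by (rule sum.cong) (auto simp: indicator_def in_cyl_iff[OF _ True])
  with True show ?thesis by (simp add: finite_words word_in)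
qed (auto simp: cyl_def indicator_def)

lemma words_0: "words X 0 = {[]}"
  using ne_X by (auto simp: words_def)

lemma Cn_words: "Cn X n = {(\<lambda>x. \<Sum>w \<in> words X n. a w * indicator (cyl X w) x) | a. True}"
proof (cases "n = 0")
  case True
  have "cyl X [] = X" by (auto simp: cyl_def window_def)
  then have *: "(\<Sum>w \<in> words X 0. b w * indicator (cyl X w) x) = b [] * indicator X x"
    for b :: "nat list \<Rightarrow> complex" and x
    by (simp add: sum_words_indicator window_def)
  have "Cn X 0 = {(\<lambda>x. \<Sum>w \<in> words X 0. b w * indicator (cyl X w) x) | b. True}"
    unfolding * Cn_def by (auto intro: exI[of _ "\<lambda>_. _ :: complex"])
  with True show ?thesis by simp
qed (simp add: Cn_def)

text \<open>The span of the cylinder functions consists of the functions of the central block alone. In this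
  form it is visibly an algebra that is closed under conjugation and increases with \<open>n\<close>.\<close>

lemma Cn_iff:
  "f \<in> Cn X n \<longleftrightarrow> (\<forall>x. x \<notin> X \<longrightarrow> f x = 0) \<and> (\<forall>x\<in>X. \<forall>y\<in>X. same n x y \<longrightarrow> f x = f y)"
  (is "?L = ?R")
proof
  assume ?L
  then obtain a where a: "\<And>x. f x = (if x \<in> X then a (map x (window n)) else 0)"
    by (auto simp: Cn_words sum_words_indicator fun_eq_iff)
  show ?R by (auto simp: a same_iff simp del: map_eq_conv)
next
  assume R: ?R
  define a where "a w = f (SOME x. x \<in> X \<and> map x (window n) = w)" for w
  have "f x = a (map x (window n))" if "x \<in> X" for x
  proof -
    let ?y = "SOME y. y \<in> X \<and> map y (window n) = map x (window n)"
    have "?y \<in> X \<and> map ?y (window n) = map x (window n)"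
      by (rule someI[of "\<lambda>y. y \<in> X \<and> map y (window n) = map x (window n)" x]) (simp add: that)
    with R that show ?thesis unfolding a_def same_iff by metis
  qed
  moreover have "f x = 0" if "x \<notin> X" for x using R that by blast
  ultimately have "f = (\<lambda>x. \<Sum>w \<in> words X n. a w * indicator (cyl X w) x)"
    by (simp add: sum_words_indicator fun_eq_iff)
  then show ?L unfolding Cn_words by blast
qed

lemma Cn_off: "f \<in> Cn X n \<Longrightarrow> x \<notin> X \<Longrightarrow> f x = 0"
  and Cn_eq: "f \<in> Cn X n \<Longrightarrow> x \<in> X \<Longrightarrow> y \<in> X \<Longrightarrow> same n x y \<Longrightarrow> f x = f y"
  unfolding Cn_iff by blast+

lemma Cn_mono: "f \<in> Cn X n \<Longrightarrow> n \<le> m \<Longrightarrow> f \<in> Cn X m"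
  using same_mono unfolding Cn_iff by blast

lemma Cn_zero [simp]: "(\<lambda>x. 0) \<in> Cn X n" by (simp add: Cn_iff)

lemma Cn_lift2:
  assumes "f \<in> Cn X n" "g \<in> Cn X n" "h 0 0 = 0"
  shows "(\<lambda>x. h (f x) (g x)) \<in> Cn X n"
  unfolding Cn_iff
proof (intro conjI allI ballI impI)
  show "h (f x) (g x) = 0" if "x \<notin> X" for x
    using assms Cn_off that by metis
  show "h (f x) (g x) = h (f y) (g y)" if "x \<in> X" "y \<in> X" "same n x y" for x y
    using Cn_eq[OF assms(1) that] Cn_eq[OF assms(2) that] by simp
qed

lemma Cn_add: "f \<in> Cn X n \<Longrightarrow> g \<in> Cn X n \<Longrightarrow> (\<lambda>x. f x + g x) \<in> Cn X n"
  and Cn_diff: "f \<in> Cn X n \<Longrightarrow> g \<in> Cn X n \<Longrightarrow> (\<lambda>x. f x - g x) \<in> Cn X n"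
  and Cn_mult: "f \<in> Cn X n \<Longrightarrow> g \<in> Cn X n \<Longrightarrow> (\<lambda>x. f x * g x) \<in> Cn X n"
  and Cn_cmult: "f \<in> Cn X n \<Longrightarrow> (\<lambda>x. c * f x) \<in> Cn X n"
  and Cn_cnj: "f \<in> Cn X n \<Longrightarrow> (\<lambda>x. cnj (f x)) \<in> Cn X n"
  by (rule Cn_lift2[where h = "(+)"] Cn_lift2[where h = "(-)"] Cn_lift2[where h = "(*)"]
        Cn_lift2[where h = "\<lambda>x y. c * x"] Cn_lift2[where h = "\<lambda>x y. cnj x"]; simp)+

lemma Cn_sum: "(\<And>k. k \<in> A \<Longrightarrow> f k \<in> Cn X n) \<Longrightarrow> (\<lambda>x. \<Sum>k\<in>A. f k x) \<in> Cn X n"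
  by (induction A rule: infinite_finite_induct) (auto intro: Cn_add)

lemma indicator_X_Cn: "indicator X \<in> Cn X n"
  by (simp add: Cn_iff)

lemma indicator_cyl_Cn: "w \<in> words X n \<Longrightarrow> indicator (cyl X w) \<in> Cn X n"
  using length_words by (auto simp: Cn_iff indicator_def cyl_def same_iff)

text \<open>A point has a neighbourhood in \<open>X\<close> on which the central block of length \<open>n\<close> does not change.\<close>

lemma continuous_on_Cn: "f \<in> Cn X n \<Longrightarrow> continuous_on X f"
  unfolding continuous_on_def
proof
  fix a assume f: "f \<in> Cn X n" and a: "a \<in> X"
  have "((\<lambda>x. x) \<longlongrightarrow> a) (at a within X)" by (rule tendsto_ident_at)
  then have "\<forall>\<^sub>F x in at a within X. \<forall>i\<in>set (window n). x i = a i"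
    by (intro eventually_ball_finite) (auto simp: tendsto_biword_iff)
  moreover have "\<forall>\<^sub>F x in at a within X. x \<in> X" by (simp add: eventually_at_filter)
  ultimately have "\<forall>\<^sub>F x in at a within X. f x = f a"
    by eventually_elim (rule Cn_eq[OF f _ a], auto simp: same_def)
  then show "(f \<longlongrightarrow> f a) (at a within X)" by (rule tendsto_eventually)
qed

lemma Cn_CX: "f \<in> Cn X n \<Longrightarrow> f \<in> CX X"
  using continuous_on_Cn Cn_off by (auto simp: CX_def)

lemma Cn_bounded: "f \<in> Cn X n \<Longrightarrow> \<exists>B>0. \<forall>x. cmod (f x) \<le> B"
proof -
  assume f: "f \<in> Cn X n"
  then have "bounded (f ` X)"
    using compact_continuous_image[OF continuous_on_Cn compact_X] compact_imp_bounded by blast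
  then obtain B where "B > 0" "\<forall>x\<in>X. cmod (f x) \<le> B"
    by (auto simp: bounded_pos)
  then show ?thesis using Cn_off[OF f] by (metis norm_zero less_imp_le)
qed

text \<open>This is uniform continuity on the compact space \<open>X\<close>. Were it to fail for every \<open>n\<close>, the offending
  pairs would accumulate at a single point, as they agree on larger and larger windows.\<close>

lemma uniformly_local:
  fixes f :: "biword \<Rightarrow> complex"
  assumes f: "continuous_on X f" and e: "e > (0::real)"
  shows "\<exists>n. \<forall>x\<in>X. \<forall>y\<in>X. same n x y \<longrightarrow> dist (f x) (f y) < e"
proof (rule ccontr)
  assume "\<not> ?thesis"
  then have "\<forall>n. \<exists>x y. x \<in> X \<and> y \<in> X \<and> same n x y \<and> dist (f x) (f y) \<ge> e"
    by (auto simp: not_less) blast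
  then obtain x y where xy: "\<And>n. x n \<in> X" "\<And>n. y n \<in> X" "\<And>n. same n (x n) (y n)"
      "\<And>n. dist (f (x n)) (f (y n)) \<ge> e" by metis
  have "seq_compact X" using compact_X by (simp add: seq_compact_eq_compact)
  then obtain l r where l: "l \<in> X" "strict_mono (r :: nat \<Rightarrow> nat)" "(x \<circ> r) \<longlonglongrightarrow> l"
    using xy(1) unfolding seq_compact_def by metis
  have "(y \<circ> r) \<longlonglongrightarrow> l"
    unfolding tendsto_biword_iff
  proof
    fix i
    have "\<forall>\<^sub>F k in sequentially. (x \<circ> r) k i = l i"
      using l(3) by (auto simp: tendsto_biword_iff)
    moreover have "\<forall>\<^sub>F k in sequentially. k > nat (2 * \<bar>i\<bar>)" by (rule eventually_gt_at_top)
    ultimately show "\<forall>\<^sub>F k in sequentially. (y \<circ> r) k i = l i"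
    proof eventually_elim
      case (elim k)
      then have "2 * \<bar>i\<bar> < int (r k)" using seq_suble[OF l(2), of k] by linarith
      then show ?case using xy(3)[of "r k"] elim in_window by (auto simp: same_def)
    qed
  qed
  then have "(\<lambda>k. dist (f (x (r k))) (f (y (r k)))) \<longlonglongrightarrow> dist (f l) (f l)"
    using l xy by (intro tendsto_dist continuous_on_tendsto_compose[OF f]) (auto simp: o_def)
  then have "e \<le> dist (f l) (f l)"
    by (rule LIMSEQ_le_const) (use xy in blast)
  with e show False by simp
qed

text \<open>Replacing \<open>f x\<close> by the value of \<open>f\<close> at one chosen point of the cylinder of \<open>x\<close> changes \<open>f\<close> by
  less than \<open>e\<close>, by uniform continuity.\<close>

lemma Cinf_dense:
  assumes f: "f \<in> CX X" and e: "e > 0"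
  shows "\<exists>g\<in>Cinf X. \<forall>x. cmod (f x - g x) < e"
proof -
  obtain n where n: "\<And>x y. x \<in> X \<Longrightarrow> y \<in> X \<Longrightarrow> same n x y \<Longrightarrow> dist (f x) (f y) < e"
    using uniformly_local[OF _ e, of f] f unfolding CX_def by blast
  define g where "g = (\<lambda>x. if x \<in> X then f (SOME y. y \<in> X \<and> same n y x) else 0)"
  have "g \<in> Cn X n"
    unfolding Cn_iff by (auto simp: g_def same_iff)
  moreover have "cmod (f x - g x) < e" for x
  proof (cases "x \<in> X")
    case True
    have "(SOME y. y \<in> X \<and> same n y x) \<in> X \<and> same n (SOME y. y \<in> X \<and> same n y x) x"
      by (rule someI[of "\<lambda>y. y \<in> X \<and> same n y x" x]) (simp add: True)
    with True n[of "SOME y. y \<in> X \<and> same n y x" x] show ?thesis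
      by (simp add: g_def dist_norm norm_minus_commute)
  qed (use f e in \<open>auto simp: g_def CX_def\<close>)
  ultimately show ?thesis by (auto simp: Cinf_def)
qed

end


section \<open>The filtration of the Hilbert space\<close>

locale invariant_subshift = subshift +
  fixes \<mu> :: "biword measure"
  assumes inv: "invariant_prob X \<mu>"
begin

lemma space_mu: "space \<mu> = X" and sets_mu: "sets \<mu> = sets (restrict_space borel X)"
  and emeasure_X: "emeasure \<mu> X = 1"
  using inv by (auto simp: invariant_prob_def)

lemma finite_measure_mu: "finite_measure \<mu>"
  by (rule finite_measureI) (simp add: space_mu emeasure_X)

lemma measure_X: "measure \<mu> X = 1"
  by (simp add: measure_def emeasure_X)

lemma sets_cyl: "cyl X w \<in> sets \<mu>"
proof -
  let ?U = "\<Inter>i\<in>{..<length w}. {x :: biword. x (window (length w) ! i) = w ! i}"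
  have "open {x :: biword. x i = c}" for i c
  proof -
    have "open ((\<lambda>x :: biword. x i) -` {c})"
      by (rule open_vimage[OF open_discrete continuous_on_product_coordinates])
    then show ?thesis by (simp add: vimage_def)
  qed
  then have "open ?U" by (intro open_INT) auto
  then have "?U \<in> sets borel" by simp
  moreover have "cyl X w = X \<inter> ?U"
    by (auto simp: cyl_def list_eq_iff_nth_eq)
  ultimately show ?thesis unfolding sets_mu sets_restrict_space by blast
qed

lemma measure_shift:
  assumes A: "A \<in> sets \<mu>"
  shows "(shift ^^ j) -` A \<inter> X \<in> sets \<mu> \<and> measure \<mu> ((shift ^^ j) -` A \<inter> X) = measure \<mu> A"
proof (induction j)
  case 0
  then show ?case using A sets.sets_into_space[OF A] by (auto simp: space_mu Int_absorb2)
next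
  case (Suc j)
  have s: "shift \<in> measurable \<mu> \<mu>" "distr \<mu> \<mu> shift = \<mu>"
    using inv by (auto simp: invariant_prob_def)
  let ?B = "(shift ^^ j) -` A \<inter> X"
  have eq: "(shift ^^ Suc j) -` A \<inter> X = shift -` ?B \<inter> space \<mu>"
    using shift_X by (auto simp: funpow_Suc_right space_mu simp del: funpow.simps)
  have "shift -` ?B \<inter> space \<mu> \<in> sets \<mu>" by (rule measurable_sets[OF s(1) conjunct1[OF Suc]])
  moreover have "measure \<mu> (shift -` ?B \<inter> space \<mu>) = measure \<mu> ?B"
    using measure_distr[OF s(1) conjunct1[OF Suc]] s(2) by simp
  ultimately show ?case using Suc unfolding eq by simp
qed

text \<open>If every orbit visits \<open>A\<close> within \<open>q\<close> steps, then \<open>q\<close> preimages of \<open>A\<close>, all of the same measure,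
  cover the space.\<close>

lemma measure_recurrent:
  assumes A: "A \<in> sets \<mu>" and rec: "\<And>z. z \<in> X \<Longrightarrow> \<exists>j<q. (shift ^^ j) z \<in> A"
  shows "1 \<le> real q * measure \<mu> A"
proof -
  let ?B = "\<lambda>j. (shift ^^ j) -` A \<inter> X"
  have "X = (\<Union>j<q. ?B j)" using rec by fastforce
  then have "1 = measure \<mu> (\<Union>j<q. ?B j)" using measure_X by simp
  also have "\<dots> \<le> (\<Sum>j<q. measure \<mu> (?B j))"
    using measure_shift[OF A] by (intro measure_UNION_le) auto
  also have "\<dots> = real q * measure \<mu> A" using measure_shift[OF A] by simp
  finally show ?thesis .
qed

lemma integral_cyl:
  "(\<integral>x. indicator (cyl X w) x \<partial>\<mu>) = measure \<mu> (cyl X w)"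
  "(\<integral>x. indicator (cyl X w) x \<partial>\<mu>) = complex_of_real (measure \<mu> (cyl X w))"
proof -
  show *: "(\<integral>x. indicator (cyl X w) x \<partial>\<mu>) = measure \<mu> (cyl X w)"
    using sets.sets_into_space[OF sets_cyl[of w]] by (simp add: Int_absorb2)
  have "(indicator (cyl X w) :: biword \<Rightarrow> complex) = (\<lambda>x. complex_of_real (indicator (cyl X w) x))"
    by (auto simp: indicator_def)
  then show "(\<integral>x. indicator (cyl X w) x \<partial>\<mu>) = complex_of_real (measure \<mu> (cyl X w))"
    using * by (simp add: integral_complex_of_real del: of_real_indicator)
qed

end

locale measured_subshift = invariant_subshift +
  assumes cyl_pos: "w \<in> words X n \<Longrightarrow> measure \<mu> (cyl X w) > 0"
begin

abbreviation sqnorm :: "(biword \<Rightarrow> complex) \<Rightarrow> real" where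
  "sqnorm f \<equiv> \<integral>x. (cmod (f x))\<^sup>2 \<partial>\<mu>"

lemma Cn_measurable: "f \<in> Cn X n \<Longrightarrow> f \<in> borel_measurable \<mu>"
  using sets_cyl by (auto simp: Cn_words intro!: borel_measurable_sum borel_measurable_times)

lemma Cn_integrable: "f \<in> Cn X n \<Longrightarrow> integrable \<mu> f"
proof -
  assume f: "f \<in> Cn X n"
  then obtain B where "\<And>x. cmod (f x) \<le> B" using Cn_bounded by blast
  then show ?thesis
    using finite_measure.integrable_const_bound[OF finite_measure_mu, of f B] Cn_measurable[OF f] by auto
qed

lemma complex_of_sq: "complex_of_real ((cmod z)\<^sup>2) = z * cnj z"
  by (rule complex_norm_square)

lemma sq_integrable: "f \<in> Cn X n \<Longrightarrow> integrable \<mu> (\<lambda>x. (cmod (f x))\<^sup>2)"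
proof -
  assume "f \<in> Cn X n"
  then have "integrable \<mu> (\<lambda>x. f x * cnj (f x))"
    by (intro Cn_integrable[of _ n] Cn_mult Cn_cnj)
  then have "integrable \<mu> (\<lambda>x. Re (complex_of_real ((cmod (f x))\<^sup>2)))"
    unfolding complex_of_sq by (rule integrable_Re)
  then show ?thesis by simp
qed

lemma Cn_L2: "f \<in> Cn X n \<Longrightarrow> f \<in> L2 \<mu>"
  by (simp add: L2_def Cn_measurable sq_integrable)

lemma sqnorm_nonneg: "sqnorm f \<ge> 0" by simp

lemma l2norm_sq: "(l2norm \<mu> f)\<^sup>2 = sqnorm f"
  by (simp add: l2norm_def)

lemma sqnorm_cmult: "sqnorm (\<lambda>x. c * f x) = (cmod c)\<^sup>2 * sqnorm f"
  by (simp add: norm_mult power_mult_distrib)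

lemma sq_le: "(cmod (a + b))\<^sup>2 \<le> 2 * (cmod a)\<^sup>2 + 2 * (cmod b)\<^sup>2"
proof -
  have "(cmod (a + b))\<^sup>2 \<le> (cmod a + cmod b)\<^sup>2"
    by (intro power_mono norm_triangle_ineq) simp
  also have "\<dots> \<le> 2 * (cmod a)\<^sup>2 + 2 * (cmod b)\<^sup>2"
    using sum_squares_bound[of "cmod a" "cmod b"] by (simp add: power2_sum)
  finally show ?thesis .
qed

text \<open>The factor \<open>2\<close> is the price for an inequality that follows pointwise from
  \<open>\<bar>a + b\<bar>\<^sup>2 \<le> 2\<bar>a\<bar>\<^sup>2 + 2\<bar>b\<bar>\<^sup>2\<close>; it is harmless for boundedness and convergence.\<close>

lemma assumes "f \<in> L2 \<mu>" "g \<in> L2 \<mu>" shows L2_add: "(\<lambda>x. f x + g x) \<in> L2 \<mu>"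
    and sqnorm_add: "sqnorm (\<lambda>x. f x + g x) \<le> 2 * sqnorm f + 2 * sqnorm g"
proof -
  have m [measurable]: "f \<in> borel_measurable \<mu>" "g \<in> borel_measurable \<mu>"
    and i: "integrable \<mu> (\<lambda>x. 2 * (cmod (f x))\<^sup>2 + 2 * (cmod (g x))\<^sup>2)"
    using assms by (auto simp: L2_def)
  have "integrable \<mu> (\<lambda>x. (cmod (f x + g x))\<^sup>2)"
    by (rule Bochner_Integration.integrable_bound[OF i]) (auto intro!: AE_I2 order_trans[OF sq_le])
  then show "(\<lambda>x. f x + g x) \<in> L2 \<mu>" by (simp add: L2_def)
  have "sqnorm (\<lambda>x. f x + g x) \<le> (\<integral>x. 2 * (cmod (f x))\<^sup>2 + 2 * (cmod (g x))\<^sup>2 \<partial>\<mu>)"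
    using i \<open>integrable \<mu> (\<lambda>x. (cmod (f x + g x))\<^sup>2)\<close> by (intro integral_mono sq_le)
  also have "\<dots> = 2 * sqnorm f + 2 * sqnorm g"
    using assms by (subst Bochner_Integration.integral_add) (auto simp: L2_def)
  finally show "sqnorm (\<lambda>x. f x + g x) \<le> 2 * sqnorm f + 2 * sqnorm g" .
qed

lemma L2_cmult: "f \<in> L2 \<mu> \<Longrightarrow> (\<lambda>x. c * f x) \<in> L2 \<mu>"
  by (auto simp: L2_def norm_mult power_mult_distrib)

lemma assumes "f \<in> L2 \<mu>" "g \<in> L2 \<mu>" shows L2_diff: "(\<lambda>x. f x - g x) \<in> L2 \<mu>"
    and sqnorm_diff: "sqnorm (\<lambda>x. f x - g x) \<le> 2 * sqnorm f + 2 * sqnorm g"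
  using L2_add[OF assms(1) L2_cmult[OF assms(2), of "-1"]]
    sqnorm_add[OF assms(1) L2_cmult[OF assms(2), of "-1"]] by auto

lemma sqnorm_mult_bound:
  assumes h: "h \<in> L2 \<mu>" and f: "f \<in> Cn X n" and B: "\<And>x. cmod (f x) \<le> B"
  shows "(\<lambda>x. f x * h x) \<in> L2 \<mu>" and "sqnorm (\<lambda>x. f x * h x) \<le> B\<^sup>2 * sqnorm h"
proof -
  have [measurable]: "f \<in> borel_measurable \<mu>" "h \<in> borel_measurable \<mu>"
    and i: "integrable \<mu> (\<lambda>x. B\<^sup>2 * (cmod (h x))\<^sup>2)"
    using h f by (auto simp: L2_def Cn_measurable)
  have le: "(cmod (f x * h x))\<^sup>2 \<le> B\<^sup>2 * (cmod (h x))\<^sup>2" for x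
    using B[of x] by (simp add: norm_mult power_mult_distrib mult_right_mono power_mono)
  have j: "integrable \<mu> (\<lambda>x. (cmod (f x * h x))\<^sup>2)"
    by (rule Bochner_Integration.integrable_bound[OF i]) (auto intro!: AE_I2 order_trans[OF le])
  then show "(\<lambda>x. f x * h x) \<in> L2 \<mu>" by (simp add: L2_def)
  show "sqnorm (\<lambda>x. f x * h x) \<le> B\<^sup>2 * sqnorm h"
    using integral_mono[OF j i le] by simp
qed

text \<open>A vector of \<open>C\<^sub>n\<close> is constant on the cylinders of length \<open>n\<close>, so its sup norm is
  controlled by its Hilbert norm and the measure of these cylinders.\<close>

lemma sup_le_sqnorm:
  assumes g: "g \<in> Cn X n" and x: "x \<in> X"
  shows "(cmod (g x))\<^sup>2 * measure \<mu> (cyl X (map x (window n))) \<le> sqnorm g"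
proof -
  let ?A = "cyl X (map x (window n))"
  have "(cmod (g x))\<^sup>2 * measure \<mu> ?A = (\<integral>y. (cmod (g x))\<^sup>2 * indicator ?A y \<partial>\<mu>)"
    by (simp only: integral_mult_right_zero integral_cyl)
  also have "\<dots> \<le> sqnorm g"
  proof (rule integral_mono)
    show "integrable \<mu> (\<lambda>y. (cmod (g x))\<^sup>2 * indicator ?A y)"
      using sets_cyl finite_measure.emeasure_finite[OF finite_measure_mu]
      by (intro integrable_mult_right integrable_real_indicator) (auto simp: less_top)
    show "(cmod (g x))\<^sup>2 * indicator ?A y \<le> (cmod (g y))\<^sup>2" for y
      using Cn_eq[OF g x, of y] by (auto simp: cyl_map_window indicator_def)
  qed (rule sq_integrable[OF g])
  finally show ?thesis .
qed

lemma sqnorm_zero_imp: "g \<in> Cn X n \<Longrightarrow> sqnorm g = 0 \<Longrightarrow> g x = 0"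
proof (cases "x \<in> X")
  case True
  assume "g \<in> Cn X n" "sqnorm g = 0"
  with sup_le_sqnorm[OF this(1) True] cyl_pos[OF word_in[OF True, of n]] show ?thesis
    by (simp add: mult_le_0_iff)
qed (rule Cn_off)

lemma inner_diff_left: "f \<in> Cn X n \<Longrightarrow> g \<in> Cn X n \<Longrightarrow> h \<in> Cn X n \<Longrightarrow>
    l2inner \<mu> (\<lambda>x. f x - g x) h = l2inner \<mu> f h - l2inner \<mu> g h"
  unfolding l2inner_def left_diff_distrib
  by (intro Bochner_Integration.integral_diff Cn_integrable[of _ n] Cn_mult Cn_cnj)

lemma inner_cmult_left: "l2inner \<mu> (\<lambda>x. c * f x) h = c * l2inner \<mu> f h"
  by (simp add: l2inner_def mult.assoc)

lemma pythagoras: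
  assumes f: "f \<in> Cn X n" and g: "g \<in> Cn X n" and o: "l2inner \<mu> g f = 0"
  shows "sqnorm (\<lambda>x. f x + g x) = sqnorm f + sqnorm g"
proof -
  have i: "integrable \<mu> (\<lambda>x. g x * cnj (f x))"
    using f g by (intro Cn_integrable[of _ n] Cn_mult Cn_cnj)
  define R where "R x = Re (g x * cnj (f x))" for x
  have R: "integrable \<mu> R" "(\<integral>x. R x \<partial>\<mu>) = 0"
    using integrable_Re[OF i] integral_Re[OF i] o by (auto simp: R_def[abs_def] l2inner_def)
  have "(cmod (f x + g x))\<^sup>2 = (cmod (f x))\<^sup>2 + (cmod (g x))\<^sup>2 + 2 * R x" for x
    unfolding cmod_power2 R_def by (simp add: power2_eq_square algebra_simps)
  then show ?thesis
    using sq_integrable[OF f] sq_integrable[OF g] R by simp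
qed

lemma eigen_Cn: "c \<in> eigenspace X \<mu> n \<Longrightarrow> c \<in> Cn X n"
  by (simp add: eigenspace_def)

lemma eigen_orth: "c \<in> eigenspace X \<mu> n \<Longrightarrow> g \<in> Cn X m \<Longrightarrow> m < n \<Longrightarrow> l2inner \<mu> c g = 0"
  using Cn_mono[of g m "n - 1"] by (auto simp: eigenspace_def)

lemma eigen_zero: "(\<lambda>x. 0) \<in> eigenspace X \<mu> n"
  by (simp add: eigenspace_def l2inner_def)

lemma eigen_cmult: "c \<in> eigenspace X \<mu> n \<Longrightarrow> (\<lambda>x. a * c x) \<in> eigenspace X \<mu> n"
  by (simp add: eigenspace_def inner_cmult_left Cn_cmult)

lemma eigen_diff: "c \<in> eigenspace X \<mu> n \<Longrightarrow> d \<in> eigenspace X \<mu> n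
    \<Longrightarrow> (\<lambda>x. c x - d x) \<in> eigenspace X \<mu> n"
  using Cn_mono[of _ "n - 1" n] inner_diff_left[of c n d] by (auto simp: eigenspace_def Cn_diff)

text \<open>Multiplication by an element of \<open>C\<^sub>m\<close> preserves \<open>C\<^sub>k\<close> for \<open>k \<ge> m\<close>, and, as the adjoint
  operator is of the same kind, also the orthogonal complement of \<open>C\<^sub>k\<close>.\<close>

lemma eigen_mult:
  assumes f: "f \<in> Cn X m" and c: "c \<in> eigenspace X \<mu> n" and "m < n"
  shows "(\<lambda>x. f x * c x) \<in> eigenspace X \<mu> n"
proof -
  have "l2inner \<mu> (\<lambda>x. f x * c x) g = 0" if g: "g \<in> Cn X (n - 1)" for g
  proof -
    have "l2inner \<mu> (\<lambda>x. f x * c x) g = l2inner \<mu> c (\<lambda>x. cnj (f x) * g x)"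
      by (simp add: l2inner_def mult_ac)
    also have "\<dots> = 0"
      using g f \<open>m < n\<close>
      by (intro eigen_orth[OF c, where m = "n - 1"] Cn_mult Cn_cnj Cn_mono[of f m "n - 1"]) auto
    finally show ?thesis .
  qed
  moreover have "(\<lambda>x. f x * c x) \<in> Cn X n"
    using Cn_mono[OF f, of n] \<open>m < n\<close> c by (intro Cn_mult) (auto simp: eigenspace_def)
  ultimately show ?thesis by (simp add: eigenspace_def)
qed

lemma partial_sum_Cn: "(\<And>k. c k \<in> eigenspace X \<mu> k) \<Longrightarrow> (\<lambda>x. \<Sum>k<N. c k x) \<in> Cn X (N - 1)"
  by (intro Cn_sum) (rule Cn_mono[OF eigen_Cn], auto)

lemma sqnorm_partial_sum:
  assumes c: "\<And>k. c k \<in> eigenspace X \<mu> k"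
  shows "sqnorm (\<lambda>x. \<Sum>k<N. c k x) = (\<Sum>k<N. sqnorm (c k))"
proof (induction N)
  case (Suc N)
  have "l2inner \<mu> (c N) (\<lambda>x. \<Sum>k<N. c k x) = 0"
  proof (cases N)
    case 0 then show ?thesis by (simp add: l2inner_def)
  next
    case (Suc M)
    with partial_sum_Cn[OF c, of N] show ?thesis by (intro eigen_orth[OF c]) auto
  qed
  then have "sqnorm (\<lambda>x. (\<Sum>k<N. c k x) + c N x) = sqnorm (\<lambda>x. \<Sum>k<N. c k x) + sqnorm (c N)"
    by (rule pythagoras[OF Cn_mono[OF partial_sum_Cn[OF c]] eigen_Cn[OF c], rotated]) auto
  with Suc show ?case by simp
qed simp


section \<open>Conditional expectations\<close>

text \<open>This is the orthogonal projection of \<open>L\<^sup>2\<close> onto \<open>C\<^sub>n\<close>: the conditional expectation for the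
  partition of \<open>X\<close> into cylinders of length \<open>n\<close>.\<close>

definition average :: "nat \<Rightarrow> (biword \<Rightarrow> complex) \<Rightarrow> biword \<Rightarrow> complex" where
  "average n f = (\<lambda>x. \<Sum>w\<in>words X n.
     (\<integral>y. f y * indicator (cyl X w) y \<partial>\<mu>) / measure \<mu> (cyl X w) * indicator (cyl X w) x)"

lemma average_Cn: "average n f \<in> Cn X n"
  unfolding average_def Cn_words mem_Collect_eq
  by (rule exI[of _ "\<lambda>w. (\<integral>y. f y * indicator (cyl X w) y \<partial>\<mu>) / measure \<mu> (cyl X w)"]) simp

lemma average_at:
  "x \<in> X \<Longrightarrow> average n f x = (\<integral>y. f y * indicator (cyl X (map x (window n))) y \<partial>\<mu>)
     / measure \<mu> (cyl X (map x (window n)))"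
  unfolding average_def sum_words_indicator by simp

lemma average_id:
  assumes f: "f \<in> Cn X n" shows "average n f = f"
proof
  fix x
  show "average n f x = f x"
  proof (cases "x \<in> X")
    case True
    let ?A = "cyl X (map x (window n))"
    have "f y * indicator ?A y = f x * indicator ?A y" for y
      using Cn_eq[OF f True, of y] by (auto simp: cyl_map_window indicator_def)
    then have "(\<integral>y. f y * indicator ?A y \<partial>\<mu>) = f x * measure \<mu> ?A"
      by (simp only: integral_mult_right_zero integral_cyl)
    with cyl_pos[OF word_in[OF True, of n]] show ?thesis
      by (simp add: average_at True)
  next
    case False
    then show ?thesis using Cn_off[OF f] Cn_off[OF average_Cn] by simp
  qed
qed

text \<open>The difference of \<open>f\<close> and its average has integral zero over every cylinder of length \<open>n\<close>, and
  \<open>g\<close> is a combination of the characteristic functions of these cylinders.\<close>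

lemma average_orth:
  assumes f: "f \<in> Cn X m" and g: "g \<in> Cn X n"
  shows "l2inner \<mu> (\<lambda>x. f x - average n f x) g = 0"
proof -
  obtain b where b: "g = (\<lambda>x. \<Sum>w\<in>words X n. b w * indicator (cyl X w) x)"
    using g by (auto simp: Cn_words)
  define h where "h = (\<lambda>x. f x - average n f x)"
  have h: "h \<in> Cn X (max m n)"
    unfolding h_def using f by (intro Cn_diff Cn_mono[OF f] Cn_mono[OF average_Cn]) auto
  have ind: "indicator (cyl X w) \<in> Cn X (max m n)" if "w \<in> words X n" for w
    using Cn_mono[OF indicator_cyl_Cn[OF that]] by simp
  have zero: "(\<integral>x. h x * indicator (cyl X w) x \<partial>\<mu>) = 0" if w: "w \<in> words X n" for w
  proof -
    let ?c = "(\<integral>y. f y * indicator (cyl X w) y \<partial>\<mu>) / measure \<mu> (cyl X w)"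
    have "h x * indicator (cyl X w) x
        = f x * indicator (cyl X w) x - ?c * indicator (cyl X w) x" for x
    proof (cases "x \<in> cyl X w")
      case True
      then have "x \<in> X" "w = map x (window n)"
        using length_words[OF w] by (auto simp: cyl_def)
      then show ?thesis using average_at[of x n f] True by (simp add: h_def)
    qed simp
    moreover have "integrable \<mu> (\<lambda>x. f x * indicator (cyl X w) x)"
      using Cn_mono[OF f, of "max m n"] ind[OF w] by (intro Cn_integrable[of _ "max m n"] Cn_mult) auto
    moreover have "integrable \<mu> (\<lambda>x. ?c * indicator (cyl X w) x)"
      using ind[OF w] by (intro Cn_integrable[of _ "max m n"] Cn_cmult)
    ultimately have "(\<integral>x. h x * indicator (cyl X w) x \<partial>\<mu>)
        = (\<integral>x. f x * indicator (cyl X w) x \<partial>\<mu>) - (\<integral>x. ?c * indicator (cyl X w) x \<partial>\<mu>)"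
      by simp
    also have "(\<integral>x. ?c * indicator (cyl X w) x \<partial>\<mu>) = ?c * measure \<mu> (cyl X w)"
      by (simp only: integral_mult_right_zero integral_cyl)
    finally show ?thesis using cyl_pos[OF w] by simp
  qed
  have "l2inner \<mu> h g = (\<integral>x. (\<Sum>w\<in>words X n. cnj (b w) * (h x * indicator (cyl X w) x)) \<partial>\<mu>)"
    unfolding l2inner_def b
    by (rule Bochner_Integration.integral_cong[OF refl])
      (auto simp: sum_distrib_left indicator_def intro!: sum.cong)
  also have "\<dots> = (\<Sum>w\<in>words X n. \<integral>x. cnj (b w) * (h x * indicator (cyl X w) x) \<partial>\<mu>)"
    using h ind by (intro Bochner_Integration.integral_sum Cn_integrable[of _ "max m n"] Cn_cmult Cn_mult)
  also have "\<dots> = 0" by (simp add: zero)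
  finally show ?thesis by (simp add: h_def)
qed

text \<open>The projection of \<open>f\<close> to \<open>C\<^sub>n \<inter> C\<^bsub>n-1\<^esub>\<^sup>\<bottom>\<close>, as a difference of the projections to \<open>C\<^sub>n\<close> and
  \<open>C\<^bsub>n-1\<^esub>\<close>.\<close>

definition component :: "(biword \<Rightarrow> complex) \<Rightarrow> nat \<Rightarrow> biword \<Rightarrow> complex" where
  "component f n = (\<lambda>x. if n = 0 then average 0 f x else average n f x - average (n - 1) f x)"

lemma component_eigen:
  assumes f: "f \<in> Cn X m" shows "component f n \<in> eigenspace X \<mu> n"
proof (cases n)
  case 0
  then show ?thesis using average_Cn[of 0 f] by (simp add: component_def eigenspace_def)
next
  case (Suc k)
  have "l2inner \<mu> (\<lambda>x. average n f x - average k f x) g = 0" if g: "g \<in> Cn X k" for g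
  proof -
    let ?M = "max m n"
    have up: "f \<in> Cn X ?M" "average n f \<in> Cn X ?M" "average k f \<in> Cn X ?M" "g \<in> Cn X ?M" "g \<in> Cn X n"
      using Suc f g by (auto intro: Cn_mono average_Cn)
    have "l2inner \<mu> (\<lambda>x. (f x - average k f x) - (f x - average n f x)) g
        = l2inner \<mu> (\<lambda>x. f x - average k f x) g - l2inner \<mu> (\<lambda>x. f x - average n f x) g"
      using up by (intro inner_diff_left[of _ ?M] Cn_diff)
    also have "\<dots> = 0" using average_orth[OF f g] average_orth[OF f up(5)] by simp
    finally show ?thesis by simp
  qed
  moreover have "component f n \<in> Cn X n"
    unfolding component_def using Suc by (auto intro!: Cn_diff average_Cn Cn_mono[OF average_Cn])
  ultimately show ?thesis using Suc by (simp add: component_def eigenspace_def)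
qed

lemma sum_component: "(\<Sum>k<Suc n. component f k x) = average n f x"
  by (induction n) (auto simp: component_def)

lemma component_zero: "f \<in> Cn X m \<Longrightarrow> m < n \<Longrightarrow> component f n = (\<lambda>x. 0)"
  using average_id[OF Cn_mono[of f m n]] average_id[OF Cn_mono[of f m "n - 1"]]
  by (auto simp: component_def)

end


context measured_subshift
begin

section \<open>Commutators with the Dirac operator\<close>

lemma l2norm_zero [simp]: "l2norm \<mu> (\<lambda>x. 0) = 0"
  by (simp add: l2norm_def)

text \<open>For \<open>f\<close> in \<open>C\<^sub>m\<close> the components beyond \<open>m\<close> vanish, so that all series in the definition of the
  Dirac operator are finite sums.\<close>

lemma dirac_Cn:
  assumes f: "f \<in> Cn X m"
  shows "dirac X \<mu> f (\<lambda>x. \<Sum>k<Suc m. of_nat k * component f k x)"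
proof -
  have stable: "(\<Sum>k<N. a k * component f k x) = (\<Sum>k<Suc m. a k * component f k x)"
    if "m < N" for a :: "nat \<Rightarrow> complex" and N :: nat and x
    using that by (intro sum.mono_neutral_right) (auto simp: component_zero[OF f])
  have f_eq: "f x = (\<Sum>k<N. component f k x)" if "N > m" for N x
    using stable[OF that, where a = "\<lambda>_. 1" and x = x] sum_component[where f = f and n = m and x = x] average_id[OF f] by simp
  have fin: "summable (\<lambda>n. (real n * l2norm \<mu> (component f n))\<^sup>2)"
    by (rule summable_finite[of "{..m}"]) (auto simp: component_zero[OF f] not_le)
  have "\<forall>\<^sub>F N in sequentially. l2norm \<mu> (\<lambda>x. f x - (\<Sum>n<N. component f n x)) = 0"
    using eventually_gt_at_top[of m] by eventually_elim (simp add: f_eq[symmetric])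
  then have lim1: "(\<lambda>N. l2norm \<mu> (\<lambda>x. f x - (\<Sum>n<N. component f n x))) \<longlonglongrightarrow> 0"
    by (rule tendsto_eventually)
  have "\<forall>\<^sub>F N in sequentially. l2norm \<mu> (\<lambda>x. (\<Sum>k<Suc m. of_nat k * component f k x)
      - (\<Sum>n<N. of_nat n * component f n x)) = 0"
    using eventually_gt_at_top[of m]
  proof eventually_elim
    case (elim N)
    show ?case by (simp only: stable[OF elim] diff_self l2norm_zero)
  qed
  then have lim2: "(\<lambda>N. l2norm \<mu> (\<lambda>x. (\<Sum>k<Suc m. of_nat k * component f k x)
      - (\<Sum>n<N. of_nat n * component f n x))) \<longlonglongrightarrow> 0"
    by (rule tendsto_eventually)
  have "(\<lambda>x. \<Sum>k<Suc m. of_nat k * component f k x) \<in> Cn X m"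
    by (intro Cn_sum Cn_cmult) (rule Cn_mono[OF eigen_Cn[OF component_eigen[OF f]]], simp)
  then show ?thesis
    unfolding dirac_def using Cn_L2[OF f] Cn_L2 fin lim1 lim2 component_eigen[OF f] by blast
qed

text \<open>The constant function is a unit vector in the kernel of the Dirac operator. Applied to it,
  the commutator with \<open>f\<close> returns the image of the vector \<open>f\<close> under the Dirac operator, whose squared
  norm is the sum of the terms below over all \<open>k\<close>, by Pythagoras' theorem.\<close>

lemma commutator_le_1_components:
  assumes f: "f \<in> Cinf X" and le: "commutator_norm X \<mu> f \<le> 1"
  shows "(\<Sum>k<N. (real k)\<^sup>2 * sqnorm (component f k)) \<le> 1"
proof -
  obtain m where m: "f \<in> Cn X m" using f by (auto simp: Cinf_def)
  define z where "z = (\<lambda>x. \<Sum>k<Suc m. of_nat k * component f k x)"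
  have one: "(indicator X :: biword \<Rightarrow> complex) \<in> Cn X 0" by (rule indicator_X_Cn)
  have d1: "dirac X \<mu> (indicator X) (\<lambda>x. 0)"
    using dirac_Cn[OF one] by simp
  have f_ind: "(\<lambda>x. f x * indicator X x) = f"
    using Cn_off[OF m] by (fastforce simp: indicator_def)
  have "sqnorm (indicator X) = (\<integral>x. indicator X x \<partial>\<mu>)"
    by (intro arg_cong[where f = "integral\<^sup>L \<mu>"]) (auto simp: indicator_def)
  then have "l2norm \<mu> (indicator X) \<le> 1"
    using measure_X space_mu by (simp add: l2norm_def)
  then have "ennreal (l2norm \<mu> (\<lambda>x. z x - f x * 0)) \<le> commutator_norm X \<mu> f"
    unfolding commutator_norm_def using d1 dirac_Cn[OF m]
    by (intro Sup_upper CollectI exI[of _ "indicator X"] exI[of _ "\<lambda>x. 0"] exI[of _ z])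
      (auto simp: f_ind z_def)
  from order_trans[OF this le] have "ennreal (l2norm \<mu> z) \<le> 1" by simp
  then have "l2norm \<mu> z \<le> 1" by (simp only: ennreal_le_1)
  then have "sqnorm z \<le> 1" by (simp add: l2norm_def)
  also have "sqnorm z = (\<Sum>k<Suc m. sqnorm (\<lambda>x. of_nat k * component f k x))"
    unfolding z_def by (rule sqnorm_partial_sum) (intro eigen_cmult component_eigen[OF m])
  also have "\<dots> = (\<Sum>k<Suc m. (real k)\<^sup>2 * sqnorm (component f k))"
    by (simp only: sqnorm_cmult norm_of_nat)
  finally have *: "(\<Sum>k<Suc m. (real k)\<^sup>2 * sqnorm (component f k)) \<le> 1" .
  have "(\<Sum>k<N. (real k)\<^sup>2 * sqnorm (component f k))
      = (\<Sum>k\<in>{..<N} \<inter> {..<Suc m}. (real k)\<^sup>2 * sqnorm (component f k))"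
  proof (rule sum.mono_neutral_right)
    show "\<forall>k\<in>{..<N} - {..<N} \<inter> {..<Suc m}. (real k)\<^sup>2 * sqnorm (component f k) = 0"
    proof
      fix k assume "k \<in> {..<N} - {..<N} \<inter> {..<Suc m}"
      then have "component f k = (\<lambda>x. 0)" by (intro component_zero[OF m]) auto
      then show "(real k)\<^sup>2 * sqnorm (component f k) = 0" by simp
    qed
  qed auto
  also have "\<dots> \<le> (\<Sum>k<Suc m. (real k)\<^sup>2 * sqnorm (component f k))"
    by (rule sum_mono2) auto
  also note *
  finally show ?thesis .
qed

text \<open>The difference of the averages is the sum of the components of \<open>f\<close> with indices \<open>k\<close> between
  \<open>a + 1\<close> and \<open>b\<close>, and each of them enters the preceding estimate with the factor
  \<open>k\<^sup>2 \<ge> (a + 1)\<^sup>2\<close>.\<close>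

lemma commutator_le_1_average:
  assumes f: "f \<in> Cinf X" and le: "commutator_norm X \<mu> f \<le> 1" and "a \<le> b"
  shows "(real (Suc a))\<^sup>2 * sqnorm (\<lambda>x. average b f x - average a f x) \<le> 1"
proof -
  obtain m where m: "f \<in> Cn X m" using f by (auto simp: Cinf_def)
  define c where "c k = (if k \<le> a then (\<lambda>x. 0) else component f k)" for k
  have c: "c k \<in> eigenspace X \<mu> k" for k
    using component_eigen[OF m] eigen_zero by (simp add: c_def)
  have "average b f x - average a f x = (\<Sum>k<Suc b. c k x)" for x
  proof -
    have "average a f x + (\<Sum>k<Suc b. c k x)
        = (\<Sum>k<Suc b. (if k \<le> a then component f k x else 0) + c k x)"
    proof -
      have "average a f x = (\<Sum>k<Suc b. if k \<le> a then component f k x else 0)"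
        unfolding sum_component[symmetric] using \<open>a \<le> b\<close>
        by (intro sum.mono_neutral_cong_left) auto
      then show ?thesis by (simp only: sum.distrib)
    qed
    also have "\<dots> = (\<Sum>k<Suc b. component f k x)"
      by (rule sum.cong) (auto simp: c_def)
    finally show ?thesis unfolding sum_component by (simp add: algebra_simps)
  qed
  then have "sqnorm (\<lambda>x. average b f x - average a f x) = (\<Sum>k<Suc b. sqnorm (c k))"
    using sqnorm_partial_sum[OF c, of "Suc b"] by simp
  then have "(real (Suc a))\<^sup>2 * sqnorm (\<lambda>x. average b f x - average a f x)
      = (\<Sum>k<Suc b. (real (Suc a))\<^sup>2 * sqnorm (c k))"
    by (simp only: sum_distrib_left)
  also have "\<dots> \<le> (\<Sum>k<Suc b. (real k)\<^sup>2 * sqnorm (component f k))"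
  proof (rule sum_mono)
    fix k
    show "(real (Suc a))\<^sup>2 * sqnorm (c k) \<le> (real k)\<^sup>2 * sqnorm (component f k)"
    proof (cases "k \<le> a")
      case False
      then have "(real (Suc a))\<^sup>2 \<le> (real k)\<^sup>2" by (intro power_mono) auto
      with False show ?thesis unfolding c_def by (simp add: mult_right_mono)
    qed (simp add: c_def)
  qed
  also have "\<dots> \<le> 1" by (rule commutator_le_1_components[OF f le])
  finally show ?thesis .
qed

text \<open>A form of Bessel's inequality, with the factor \<open>2\<close> that comes from the weak triangle
  inequality for \<open>sqnorm\<close>.\<close>

lemma partial_sum_sqnorm_le:
  assumes c: "\<And>k. c k \<in> eigenspace X \<mu> k" and h: "h \<in> L2 \<mu>"
    and lim: "(\<lambda>N. l2norm \<mu> (\<lambda>x. h x - (\<Sum>n<N. c n x))) \<longlonglongrightarrow> 0"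
  shows "(\<Sum>k<M. sqnorm (c k)) \<le> 2 * sqnorm h"
proof (rule LIMSEQ_le_const)
  have "(\<lambda>N. (l2norm \<mu> (\<lambda>x. h x - (\<Sum>n<N. c n x)))\<^sup>2) \<longlonglongrightarrow> 0\<^sup>2"
    by (intro tendsto_power lim)
  then show "(\<lambda>N. 2 * sqnorm h + 2 * sqnorm (\<lambda>x. h x - (\<Sum>n<N. c n x))) \<longlonglongrightarrow> 2 * sqnorm h"
    by (auto simp: l2norm_sq intro!: tendsto_eq_intros)
  show "\<exists>N0. \<forall>N\<ge>N0. (\<Sum>k<M. sqnorm (c k)) \<le> 2 * sqnorm h + 2 * sqnorm (\<lambda>x. h x - (\<Sum>n<N. c n x))"
  proof (intro exI allI impI)
    fix N assume "N \<ge> M"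
    have s: "(\<lambda>x. \<Sum>n<N. c n x) \<in> L2 \<mu>" by (rule Cn_L2[OF partial_sum_Cn[OF c]])
    have "(\<Sum>k<M. sqnorm (c k)) \<le> (\<Sum>k<N. sqnorm (c k))"
      using \<open>N \<ge> M\<close> by (intro sum_mono2) auto
    also have "\<dots> = sqnorm (\<lambda>x. \<Sum>n<N. c n x)" by (rule sqnorm_partial_sum[OF c, symmetric])
    also have "\<dots> \<le> 2 * sqnorm h + 2 * sqnorm (\<lambda>x. h x - (\<Sum>n<N. c n x))"
      using sqnorm_diff[OF h L2_diff[OF h s]] by simp
    finally show "(\<Sum>k<M. sqnorm (c k)) \<le> 2 * sqnorm h + 2 * sqnorm (\<lambda>x. h x - (\<Sum>n<N. c n x))" .
  qed
qed

text \<open>An element \<open>f\<close> of \<open>C\<^sub>m\<close> maps the eigenspaces for \<open>k > m\<close> to themselves. The components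
  \<open>d\<^sub>k\<close> of \<open>f\<xi>\<close> and the products \<open>f c\<^sub>k\<close> with the components of \<open>\<xi>\<close> therefore agree for \<open>k > m\<close>, and
  the commutator only sees the finitely many eigenvalues up to \<open>m\<close>.\<close>

lemma commutator_norm_Cn:
  assumes f: "f \<in> Cn X m" and B: "\<And>x. cmod (f x) \<le> B"
  shows "commutator_norm X \<mu> f \<le> ennreal (4 * real m * B)"
  unfolding commutator_norm_def
proof (rule Sup_least, clarify)
  fix \<xi> \<eta> \<zeta>
  assume d1: "dirac X \<mu> \<xi> \<eta>" and d2: "dirac X \<mu> (\<lambda>x. f x * \<xi> x) \<zeta>" and le1: "l2norm \<mu> \<xi> \<le> 1"
  have B0: "B \<ge> 0" using B[of undefined] norm_ge_zero by (rule order_trans[rotated])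
  obtain c where L: "\<xi> \<in> L2 \<mu>" "\<eta> \<in> L2 \<mu>" and c: "\<And>k. c k \<in> eigenspace X \<mu> k"
    and lc: "(\<lambda>N. l2norm \<mu> (\<lambda>x. \<xi> x - (\<Sum>n<N. c n x))) \<longlonglongrightarrow> 0"
    and lce: "(\<lambda>N. l2norm \<mu> (\<lambda>x. \<eta> x - (\<Sum>n<N. of_nat n * c n x))) \<longlonglongrightarrow> 0"
    using d1 unfolding dirac_def by blast
  obtain d where L': "(\<lambda>x. f x * \<xi> x) \<in> L2 \<mu>" "\<zeta> \<in> L2 \<mu>" and d: "\<And>k. d k \<in> eigenspace X \<mu> k"
    and ld: "(\<lambda>N. l2norm \<mu> (\<lambda>x. f x * \<xi> x - (\<Sum>n<N. d n x))) \<longlonglongrightarrow> 0"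
    and lde: "(\<lambda>N. l2norm \<mu> (\<lambda>x. \<zeta> x - (\<Sum>n<N. of_nat n * d n x))) \<longlonglongrightarrow> 0"
    using d2 unfolding dirac_def by blast
  have sq0: "(\<lambda>N. sqnorm (g N)) \<longlonglongrightarrow> 0" if "(\<lambda>N. l2norm \<mu> (g N)) \<longlonglongrightarrow> 0" for g
    using tendsto_power[OF that, of 2] by (simp add: l2norm_sq)
  note bound = sqnorm_mult_bound[OF _ f B]
  define a where "a k = (\<lambda>x. d k x - f x * c k x)" for k
  have ps: "(\<lambda>x. \<Sum>n<N. of_nat n * c n x) \<in> L2 \<mu>" "(\<lambda>x. \<Sum>n<N. of_nat n * d n x) \<in> L2 \<mu>"
      "(\<lambda>x. \<Sum>n<N. c n x) \<in> L2 \<mu>" "(\<lambda>x. \<Sum>n<N. d n x) \<in> L2 \<mu>" for N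
    by (rule Cn_L2[OF partial_sum_Cn], intro eigen_cmult c d)+
  \<comment> \<open>Both \<open>\<Sum>d\<^sub>n\<close> and \<open>f \<cdot> \<Sum>c\<^sub>n\<close> converge in norm to \<open>f\<xi>\<close>, so the sums of the \<open>a\<^sub>n\<close> tend to zero.\<close>
  have lim_a: "(\<lambda>N. sqnorm (\<lambda>x. \<Sum>n<N. a n x)) \<longlonglongrightarrow> 0"
  proof (rule tendsto_sandwich[OF _ _ tendsto_const])
    let ?s = "\<lambda>N. 2 * (B\<^sup>2 * sqnorm (\<lambda>x. \<xi> x - (\<Sum>n<N. c n x)))
        + 2 * sqnorm (\<lambda>x. f x * \<xi> x - (\<Sum>n<N. d n x))"
    show "?s \<longlonglongrightarrow> 0" by (auto intro!: tendsto_eq_intros sq0[OF lc] sq0[OF ld])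
    show "\<forall>\<^sub>F N in sequentially. sqnorm (\<lambda>x. \<Sum>n<N. a n x) \<le> ?s N"
    proof (intro always_eventually allI)
      fix N
      have "(\<Sum>n<N. a n x)
          = f x * (\<xi> x - (\<Sum>n<N. c n x)) - (f x * \<xi> x - (\<Sum>n<N. d n x))" for x
        by (auto simp: a_def sum_subtractf sum_distrib_left algebra_simps)
      then have "sqnorm (\<lambda>x. \<Sum>n<N. a n x) \<le> 2 * sqnorm (\<lambda>x. f x * (\<xi> x - (\<Sum>n<N. c n x)))
          + 2 * sqnorm (\<lambda>x. f x * \<xi> x - (\<Sum>n<N. d n x))"
        using sqnorm_diff[OF bound(1)[OF L2_diff[OF L(1) ps(3)[of N]]] L2_diff[OF L'(1) ps(4)[of N]]] by (simp only:)
      with bound(2)[OF L2_diff[OF L(1) ps(3)[of N]]] show "sqnorm (\<lambda>x. \<Sum>n<N. a n x) \<le> ?s N" by linarith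
    qed
  qed simp
  have a_eig: "a k \<in> eigenspace X \<mu> k" if "k > m" for k
    unfolding a_def using that by (intro eigen_diff d eigen_mult[OF f c])
  have a_Cn: "a k \<in> Cn X N" if "k \<le> N" "m \<le> N" for k N
    unfolding a_def using that
    by (intro Cn_diff Cn_mult Cn_mono[OF f] Cn_mono[OF eigen_Cn[OF c]] Cn_mono[OF eigen_Cn[OF d]]) auto
  have step: "sqnorm (\<lambda>x. \<Sum>n<Suc N. a n x) = sqnorm (\<lambda>x. \<Sum>n<N. a n x) + sqnorm (a N)" if "N > m" for N
  proof -
    have s: "(\<lambda>x. \<Sum>n<N. a n x) \<in> Cn X (N - 1)"
      using that by (intro Cn_sum a_Cn) auto
    show ?thesis
      using pythagoras[OF Cn_mono[OF s, of N] a_Cn[of N N] eigen_orth[OF a_eig[OF that] s]] that by simp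
  qed
  have mono: "sqnorm (\<lambda>x. \<Sum>n<N. a n x) \<le> sqnorm (\<lambda>x. \<Sum>n<N+i. a n x)" if "N > m" for N i
  proof (induction i)
    case (Suc i)
    with step[OF trans_less_add1[OF that, of i]] sqnorm_nonneg[of "a (N + i)"] show ?case
      unfolding add_Suc_right by linarith
  qed simp
  \<comment> \<open>From index \<open>m + 1\<close> on the norms of these sums increase, and their limit is zero.\<close>
  have zero: "sqnorm (\<lambda>x. \<Sum>n<N. a n x) = 0" if "N > m" for N
  proof -
    have "sqnorm (\<lambda>x. \<Sum>n<N. a n x) \<le> 0"
    proof (rule LIMSEQ_le_const[OF lim_a], intro exI allI impI)
      fix M assume "M \<ge> N"
      then show "sqnorm (\<lambda>x. \<Sum>n<N. a n x) \<le> sqnorm (\<lambda>x. \<Sum>n<M. a n x)"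
        using mono[OF that, of "M - N"] by simp
    qed
    then show ?thesis using sqnorm_nonneg by (rule order_antisym)
  qed
  have a_zero: "a k x = 0" if "k > m" for k x
  proof (rule sqnorm_zero_imp)
    show "a k \<in> Cn X k" using that by (intro a_Cn) auto
    show "sqnorm (a k) = 0"
      using step[OF that] zero[OF that] zero[OF less_SucI[OF that]] by linarith
  qed
  define u where "u = (\<lambda>x. \<zeta> x - f x * \<eta> x)"
  define v where "v = (\<lambda>x. \<Sum>n<Suc m. of_nat n * a n x)"
  have v_eq: "v = (\<lambda>x. (\<Sum>n<N. of_nat n * d n x) - f x * (\<Sum>n<N. of_nat n * c n x))" if "N > m" for N
  proof
    fix x
    have "v x = (\<Sum>n<N. of_nat n * a n x)"
      unfolding v_def using that a_zero by (intro sum.mono_neutral_left) auto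
    then show "v x = (\<Sum>n<N. of_nat n * d n x) - f x * (\<Sum>n<N. of_nat n * c n x)"
      by (simp add: a_def sum_subtractf sum_distrib_left algebra_simps)
  qed
  have vL: "v \<in> L2 \<mu>"
    unfolding v_eq[of "Suc m", OF lessI] by (rule L2_diff[OF ps(2) bound(1)[OF ps(1)]])
  have "sqnorm u \<le> 2 * sqnorm v"
  proof (rule LIMSEQ_le_const)
    let ?s = "\<lambda>N. 2 * sqnorm v + 2 * (2 * sqnorm (\<lambda>x. \<zeta> x - (\<Sum>n<N. of_nat n * d n x))
        + 2 * (B\<^sup>2 * sqnorm (\<lambda>x. \<eta> x - (\<Sum>n<N. of_nat n * c n x))))"
    show "?s \<longlonglongrightarrow> 2 * sqnorm v"
      by (auto intro!: tendsto_eq_intros sq0[OF lce] sq0[OF lde])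
    show "\<exists>N0. \<forall>N\<ge>N0. sqnorm u \<le> ?s N"
    proof (intro exI allI impI)
      fix N assume "N \<ge> Suc m"
      let ?p = "\<lambda>x. \<zeta> x - (\<Sum>n<N. of_nat n * d n x)"
      let ?q = "\<lambda>x. \<eta> x - (\<Sum>n<N. of_nat n * c n x)"
      have p: "?p \<in> L2 \<mu>" and q: "?q \<in> L2 \<mu>" by (intro L2_diff L' L ps)+
      have "u = (\<lambda>x. v x + (?p x - f x * ?q x))"
        using v_eq[of N] \<open>N \<ge> Suc m\<close> by (auto simp: u_def algebra_simps)
      then have 1: "sqnorm u \<le> 2 * sqnorm v + 2 * sqnorm (\<lambda>x. ?p x - f x * ?q x)"
        using sqnorm_add[OF vL L2_diff[OF p bound(1)[OF q]]] by simp
      have 2: "sqnorm (\<lambda>x. ?p x - f x * ?q x) \<le> 2 * sqnorm ?p + 2 * sqnorm (\<lambda>x. f x * ?q x)"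
        by (rule sqnorm_diff[OF p bound(1)[OF q]])
      have "a \<le> 2 * b + 2 * (2 * p + 2 * s)"
        if "a \<le> 2 * b + 2 * w" "w \<le> 2 * p + 2 * r" "r \<le> s" for a b w p r s :: real
        using that by simp
      from this[OF 1 2 bound(2)[OF q]] show "sqnorm u \<le> ?s N" .
    qed
  qed
  \<comment> \<open>On the eigenspaces up to \<open>m\<close> the Dirac operator has norm at most \<open>m\<close>.\<close>
  moreover have "sqnorm v \<le> 8 * (real m)\<^sup>2 * B\<^sup>2"
  proof -
    have block: "sqnorm (\<lambda>x. \<Sum>n<Suc m. of_nat n * e n x) \<le> 2 * (real m)\<^sup>2 * sqnorm h"
      if e: "\<And>k. e k \<in> eigenspace X \<mu> k" and h: "h \<in> L2 \<mu>"
        and l: "(\<lambda>N. l2norm \<mu> (\<lambda>x. h x - (\<Sum>n<N. e n x))) \<longlonglongrightarrow> 0" for e h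
    proof -
      have "sqnorm (\<lambda>x. \<Sum>n<Suc m. of_nat n * e n x) = (\<Sum>n<Suc m. sqnorm (\<lambda>x. of_nat n * e n x))"
        by (rule sqnorm_partial_sum) (intro eigen_cmult e)
      also have "\<dots> = (\<Sum>n<Suc m. (real n)\<^sup>2 * sqnorm (e n))"
        by (simp only: sqnorm_cmult norm_of_nat)
      also have "\<dots> \<le> (\<Sum>n<Suc m. (real m)\<^sup>2 * sqnorm (e n))"
        by (intro sum_mono mult_right_mono power_mono) auto
      also have "\<dots> = (real m)\<^sup>2 * (\<Sum>n<Suc m. sqnorm (e n))" by (simp only: sum_distrib_left)
      also have "\<dots> \<le> (real m)\<^sup>2 * (2 * sqnorm h)"
        by (intro mult_left_mono partial_sum_sqnorm_le[OF e h l]) simp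
      finally show ?thesis by simp
    qed
    have xi1: "sqnorm \<xi> \<le> 1" using le1 by (simp add: l2norm_def)
    have "sqnorm v \<le> 2 * sqnorm (\<lambda>x. \<Sum>n<Suc m. of_nat n * d n x)
        + 2 * sqnorm (\<lambda>x. f x * (\<Sum>n<Suc m. of_nat n * c n x))"
      unfolding v_eq[of "Suc m", OF lessI] by (rule sqnorm_diff[OF ps(2) bound(1)[OF ps(1)]])
    also have "\<dots> \<le> 2 * (2 * (real m)\<^sup>2 * sqnorm (\<lambda>x. f x * \<xi> x))
        + 2 * (B\<^sup>2 * (2 * (real m)\<^sup>2 * sqnorm \<xi>))"
      using block[OF d L'(1) ld] mult_left_mono[OF block[OF c L(1) lc], of "B\<^sup>2"] bound(2)[OF ps(1)[of "Suc m"]]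
      by simp
    also have "\<dots> \<le> 2 * (2 * (real m)\<^sup>2 * (B\<^sup>2 * 1)) + 2 * (B\<^sup>2 * (2 * (real m)\<^sup>2 * 1))"
      using xi1 order_trans[OF bound(2)[OF L(1)] mult_left_mono[OF xi1, of "B\<^sup>2"]]
      by (intro add_mono mult_left_mono) auto
    finally show ?thesis by (simp add: mult_ac)
  qed
  ultimately have "sqnorm u \<le> (4 * real m * B)\<^sup>2" by (simp add: power_mult_distrib)
  then have "l2norm \<mu> u \<le> 4 * real m * B"
    unfolding l2norm_def using B0 by (intro real_le_lsqrt) auto
  then show "ennreal (l2norm \<mu> (\<lambda>x. \<zeta> x - f x * \<eta> x)) \<le> ennreal (4 * real m * B)"
    unfolding u_def by (rule ennreal_leI)
qed

end


section \<open>States\<close>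

context subshift
begin

lemma CX_add: "f \<in> CX X \<Longrightarrow> g \<in> CX X \<Longrightarrow> (\<lambda>x. f x + g x) \<in> CX X"
  and CX_diff: "f \<in> CX X \<Longrightarrow> g \<in> CX X \<Longrightarrow> (\<lambda>x. f x - g x) \<in> CX X"
  and CX_cmult: "f \<in> CX X \<Longrightarrow> (\<lambda>x. c * f x) \<in> CX X"
  by (auto simp: CX_def intro!: continuous_intros)

lemma indicator_X_CX: "indicator X \<in> CX X"
  by (rule Cn_CX[OF indicator_X_Cn[of 0]])

lemma state_add: "\<phi> \<in> states X \<Longrightarrow> f \<in> CX X \<Longrightarrow> g \<in> CX X \<Longrightarrow> \<phi> (\<lambda>x. f x + g x) = \<phi> f + \<phi> g"
  and state_cmult: "\<phi> \<in> states X \<Longrightarrow> f \<in> CX X \<Longrightarrow> \<phi> (\<lambda>x. a * f x) = a * \<phi> f"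
  and state_nonneg: "\<phi> \<in> states X \<Longrightarrow> f \<in> CX X \<Longrightarrow> (\<And>x. f x \<in> \<real>\<^sub>\<ge>\<^sub>0) \<Longrightarrow> \<phi> f \<in> \<real>\<^sub>\<ge>\<^sub>0"
  and state_one: "\<phi> \<in> states X \<Longrightarrow> \<phi> (indicator X) = 1"
  by (auto simp: states_def)

lemma state_diff:
  assumes p: "\<phi> \<in> states X" and f: "f \<in> CX X" and g: "g \<in> CX X"
  shows "\<phi> (\<lambda>x. f x - g x) = \<phi> f - \<phi> g"
  using state_add[OF p f CX_cmult[OF g, of "-1"]] state_cmult[OF p g, of "-1"] by simp

lemma state_sum:
  assumes p: "\<phi> \<in> states X" and "finite A" and f: "\<And>w. w \<in> A \<Longrightarrow> f w \<in> CX X"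
  shows "(\<lambda>x. \<Sum>w\<in>A. b w * f w x) \<in> CX X \<and> \<phi> (\<lambda>x. \<Sum>w\<in>A. b w * f w x) = (\<Sum>w\<in>A. b w * \<phi> (f w))"
  using assms(2,3)
proof (induction A rule: finite_induct)
  case empty
  have "\<phi> (\<lambda>x. 0 * indicator X x) = 0"
    using state_cmult[OF p indicator_X_CX, of 0] by (simp only: mult_zero_left)
  then show ?case by (simp add: CX_def)
next
  case (insert w A)
  then show ?case
    using state_add[OF p CX_cmult[of "f w" "b w"]] state_cmult[OF p, of "f w" "b w"]
      CX_add[OF CX_cmult[of "f w" "b w"]] by simp
qed

text \<open>The functions \<open>B \<plusminus> u\<close> are nonnegative, and positivity puts their images under \<open>\<phi>\<close>, which are
  \<open>B \<plusminus> \<phi> u\<close>, on the nonnegative half-line.\<close>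

lemma state_real_bound:
  assumes p: "\<phi> \<in> states X" and u: "(\<lambda>x. complex_of_real (u x)) \<in> CX X" and B: "\<And>x. \<bar>u x\<bar> \<le> B"
  shows "cmod (\<phi> (\<lambda>x. complex_of_real (u x))) \<le> B"
proof -
  define U where "U = (\<lambda>x. complex_of_real (u x))"
  have U: "U \<in> CX X" using u by (simp add: U_def)
  define c where "c = (\<lambda>x. complex_of_real B * indicator X x)"
  have c: "c \<in> CX X" unfolding c_def by (rule CX_cmult[OF indicator_X_CX])
  have pc: "\<phi> c = of_real B"
    unfolding c_def using state_cmult[OF p indicator_X_CX] state_one[OF p] by simp
  have nn: "complex_of_real r \<in> \<real>\<^sub>\<ge>\<^sub>0" if "r \<ge> 0" for r using that by simp
  have off: "u x = 0" if "x \<notin> X" for x using U that by (auto simp: CX_def U_def)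
  have "\<phi> (\<lambda>x. c x - U x) \<in> \<real>\<^sub>\<ge>\<^sub>0"
  proof (rule state_nonneg[OF p CX_diff[OF c U]])
    fix x
    have "c x - U x = of_real ((if x \<in> X then B else 0) - u x)"
      by (simp add: c_def U_def)
    moreover have "(if x \<in> X then B else 0) - u x \<ge> 0"
      using B[of x] off[of x] by (auto simp: abs_le_iff)
    ultimately show "c x - U x \<in> \<real>\<^sub>\<ge>\<^sub>0" by (simp only: nn)
  qed
  then have 1: "of_real B - \<phi> U \<in> \<real>\<^sub>\<ge>\<^sub>0" by (simp add: state_diff[OF p c U] pc)
  have "\<phi> (\<lambda>x. c x + U x) \<in> \<real>\<^sub>\<ge>\<^sub>0"
  proof (rule state_nonneg[OF p CX_add[OF c U]])
    fix x
    have "c x + U x = of_real ((if x \<in> X then B else 0) + u x)"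
      by (simp add: c_def U_def)
    moreover have "(if x \<in> X then B else 0) + u x \<ge> 0"
      using B[of x] off[of x] by (auto simp: abs_le_iff)
    ultimately show "c x + U x \<in> \<real>\<^sub>\<ge>\<^sub>0" by (simp only: nn)
  qed
  then have 2: "of_real B + \<phi> U \<in> \<real>\<^sub>\<ge>\<^sub>0" by (simp add: state_add[OF p c U] pc)
  from 1 2 have "Im (\<phi> U) = 0" "\<bar>Re (\<phi> U)\<bar> \<le> B"
    by (auto simp: complex_nonneg_Reals_iff)
  then show ?thesis by (simp add: cmod_def U_def)
qed

text \<open>The real and the imaginary part are estimated separately, whence the factor \<open>2\<close>.\<close>

lemma state_bound:
  assumes p: "\<phi> \<in> states X" and f: "f \<in> CX X" and B: "\<And>x. cmod (f x) \<le> B"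
  shows "cmod (\<phi> f) \<le> 2 * B"
proof -
  have re: "(\<lambda>x. complex_of_real (Re (f x))) \<in> CX X" and im: "(\<lambda>x. complex_of_real (Im (f x))) \<in> CX X"
    using f by (auto simp: CX_def intro!: continuous_intros)
  have "f = (\<lambda>x. complex_of_real (Re (f x)) + \<i> * complex_of_real (Im (f x)))"
    using complex_eq by auto
  then have "\<phi> f = \<phi> (\<lambda>x. complex_of_real (Re (f x))) + \<i> * \<phi> (\<lambda>x. complex_of_real (Im (f x)))"
    using state_add[OF p re CX_cmult[OF im, of \<i>]] state_cmult[OF p im, of \<i>] by simp
  then have "cmod (\<phi> f) \<le> cmod (\<phi> (\<lambda>x. complex_of_real (Re (f x))))
      + cmod (\<i> * \<phi> (\<lambda>x. complex_of_real (Im (f x))))"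
    using norm_triangle_ineq by metis
  also have "cmod (\<i> * \<phi> (\<lambda>x. complex_of_real (Im (f x)))) = cmod (\<phi> (\<lambda>x. complex_of_real (Im (f x))))"
    by (simp add: norm_mult)
  also have "cmod (\<phi> (\<lambda>x. complex_of_real (Re (f x)))) + cmod (\<phi> (\<lambda>x. complex_of_real (Im (f x)))) \<le> B + B"
    by (intro add_mono state_real_bound[OF p re] state_real_bound[OF p im])
      (meson B abs_Re_le_cmod abs_Im_le_cmod order_trans)+
  finally show ?thesis by simp
qed

end


section \<open>The Connes topology\<close>

lemma openin_connes_topology:
  "openin (connes_topology X \<mu>) U \<longleftrightarrow> U \<subseteq> states X \<and>
     (\<forall>\<phi> \<in> U. \<exists>r>0. \<forall>\<psi> \<in> states X. connes_dist X \<mu> \<phi> \<psi> < r \<longrightarrow> \<psi> \<in> U)"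
proof -
  let ?P = "\<lambda>U. U \<subseteq> states X \<and>
     (\<forall>\<phi> \<in> U. \<exists>r>0. \<forall>\<psi> \<in> states X. connes_dist X \<mu> \<phi> \<psi> < r \<longrightarrow> \<psi> \<in> U)"
  have "istopology ?P"
    unfolding istopology_def
  proof (intro conjI allI impI)
    fix S T assume S: "?P S" and T: "?P T"
    show "S \<inter> T \<subseteq> states X" using S by blast
    show "\<forall>\<phi>\<in>S \<inter> T. \<exists>r>0. \<forall>\<psi>\<in>states X. connes_dist X \<mu> \<phi> \<psi> < r \<longrightarrow> \<psi> \<in> S \<inter> T"
    proof
      fix \<phi> assume "\<phi> \<in> S \<inter> T"
      with S T obtain r1 r2 where "r1 > 0" "r2 > 0"
        "\<forall>\<psi>\<in>states X. connes_dist X \<mu> \<phi> \<psi> < r1 \<longrightarrow> \<psi> \<in> S"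
        "\<forall>\<psi>\<in>states X. connes_dist X \<mu> \<phi> \<psi> < r2 \<longrightarrow> \<psi> \<in> T"
        by (metis IntE)
      then show "\<exists>r>0. \<forall>\<psi>\<in>states X. connes_dist X \<mu> \<phi> \<psi> < r \<longrightarrow> \<psi> \<in> S \<inter> T"
        by (intro exI[of _ "min r1 r2"]) auto
    qed
  next
    fix K assume K: "\<forall>S\<in>K. ?P S"
    show "\<Union> K \<subseteq> states X" using K by blast
    show "\<forall>\<phi>\<in>\<Union> K. \<exists>r>0. \<forall>\<psi>\<in>states X. connes_dist X \<mu> \<phi> \<psi> < r \<longrightarrow> \<psi> \<in> \<Union> K"
    proof
      fix \<phi> assume "\<phi> \<in> \<Union> K"
      then obtain S where "S \<in> K" "\<phi> \<in> S" by blast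
      with K obtain r where "r > 0" "\<forall>\<psi>\<in>states X. connes_dist X \<mu> \<phi> \<psi> < r \<longrightarrow> \<psi> \<in> S" by blast
      with \<open>S \<in> K\<close> show "\<exists>r>0. \<forall>\<psi>\<in>states X. connes_dist X \<mu> \<phi> \<psi> < r \<longrightarrow> \<psi> \<in> \<Union> K" by blast
    qed
  qed
  then show ?thesis unfolding connes_topology_def by simp
qed

lemma topspace_connes_topology: "topspace (connes_topology X \<mu>) = states X"
proof
  have "openin (connes_topology X \<mu>) (topspace (connes_topology X \<mu>))" by (rule openin_topspace)
  then show "topspace (connes_topology X \<mu>) \<subseteq> states X"
    unfolding openin_connes_topology by (rule conjunct1)
  have "openin (connes_topology X \<mu>) (states X)"
    unfolding openin_connes_topology by (auto intro: exI[of _ 1])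
  then show "states X \<subseteq> topspace (connes_topology X \<mu>)" by (rule openin_subset)
qed

lemma connes_dist_ge:
  "f \<in> Cinf X \<Longrightarrow> commutator_norm X \<mu> f \<le> 1 \<Longrightarrow> ennreal (cmod (\<phi> f - \<psi> f)) \<le> connes_dist X \<mu> \<phi> \<psi>"
  unfolding connes_dist_def by (rule SUP_upper) simp

context measured_subshift
begin

text \<open>The commutator with \<open>f\<close> is bounded, so a fixed multiple \<open>f/K\<close> competes in the supremum that
  defines the Connes metric.\<close>

lemma connes_ball_Cinf:
  assumes f: "f \<in> Cinf X"
  obtains K where "K > 0" "\<And>\<phi> \<psi> e. \<phi> \<in> states X \<Longrightarrow> \<psi> \<in> states X \<Longrightarrow>
    connes_dist X \<mu> \<phi> \<psi> < ennreal e \<Longrightarrow> cmod (\<phi> f - \<psi> f) \<le> K * e"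
proof -
  obtain m where m: "f \<in> Cn X m" using f by (auto simp: Cinf_def)
  obtain B where B: "B > 0" "\<And>x. cmod (f x) \<le> B" using Cn_bounded[OF m] by blast
  define K where "K = 4 * real m * B + 1"
  have K: "K > 0" using B by (simp add: K_def add_nonneg_pos)
  define g where "g = (\<lambda>x. complex_of_real (1 / K) * f x)"
  have g: "g \<in> Cn X m" unfolding g_def by (rule Cn_cmult[OF m])
  have "cmod (g x) \<le> B / K" for x
    using B(2)[of x] K by (simp add: g_def norm_mult norm_divide divide_right_mono)
  from commutator_norm_Cn[OF g this]
  have "commutator_norm X \<mu> g \<le> ennreal (4 * real m * (B / K))" .
  also have "\<dots> \<le> 1"
    using K by (simp add: ennreal_le_1 K_def)
  finally have le: "commutator_norm X \<mu> g \<le> 1" .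
  have gi: "g \<in> Cinf X" using g by (auto simp: Cinf_def)
  have "cmod (\<phi> f - \<psi> f) \<le> K * e"
    if st: "\<phi> \<in> states X" "\<psi> \<in> states X" and d: "connes_dist X \<mu> \<phi> \<psi> < ennreal e" for \<phi> \<psi> e
  proof -
    have "\<phi> g - \<psi> g = of_real (1 / K) * (\<phi> f - \<psi> f)"
      unfolding g_def state_cmult[OF st(1) Cn_CX[OF m]] state_cmult[OF st(2) Cn_CX[OF m]]
      by (simp add: algebra_simps)
    then have *: "cmod (\<phi> g - \<psi> g) = cmod (\<phi> f - \<psi> f) / K"
      using K by (simp add: norm_mult norm_divide)
    have "ennreal (cmod (\<phi> g - \<psi> g)) < ennreal e"
      using connes_dist_ge[OF gi le] d by (rule le_less_trans)
    then have "cmod (\<phi> g - \<psi> g) < e"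
      by (subst (asm) ennreal_less_iff) auto
    then show ?thesis using K unfolding * by (simp add: field_simps)
  qed
  with K that show ?thesis by blast
qed

text \<open>For locally constant functions this is the previous lemma. The general case follows by uniform
  approximation, as states are uniformly bounded.\<close>

lemma connes_continuous_eval:
  assumes f: "f \<in> CX X"
  shows "continuous_map (connes_topology X \<mu>) euclidean (\<lambda>\<phi>. \<phi> f)"
  unfolding continuous_map
proof (intro conjI allI impI)
  note top = topspace_connes_topology
  show "(\<lambda>\<phi>. \<phi> f) ` topspace (connes_topology X \<mu>) \<subseteq> topspace euclidean" by simp
  fix V assume "openin euclidean (V :: complex set)"
  then have V: "open V" by simp
  show "openin (connes_topology X \<mu>) {\<phi> \<in> topspace (connes_topology X \<mu>). \<phi> f \<in> V}"
    unfolding openin_connes_topology top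
  proof (intro conjI ballI)
    fix \<phi> assume "\<phi> \<in> {\<phi> \<in> states X. \<phi> f \<in> V}"
    then have \<phi>: "\<phi> \<in> states X" "\<phi> f \<in> V" by auto
    obtain e where e: "e > 0" "\<And>z. dist z (\<phi> f) < e \<Longrightarrow> z \<in> V"
      using V \<phi> unfolding open_dist by metis
    obtain g where g: "g \<in> Cinf X" "\<And>x. cmod (f x - g x) < e / 8"
      using Cinf_dense[OF f, of "e / 8"] e by auto
    then have gC: "g \<in> CX X" using Cn_CX by (auto simp: Cinf_def)
    obtain K where K: "K > 0" "\<And>\<phi> \<psi> e. \<phi> \<in> states X \<Longrightarrow> \<psi> \<in> states X \<Longrightarrow>
        connes_dist X \<mu> \<phi> \<psi> < ennreal e \<Longrightarrow> cmod (\<phi> g - \<psi> g) \<le> K * e"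
      using connes_ball_Cinf[OF g(1)] by metis
    have close: "cmod (\<psi> f - \<psi> g) \<le> e / 4" if "\<psi> \<in> states X" for \<psi>
      using state_bound[OF that CX_diff[OF f gC], of "e / 8"] g(2) state_diff[OF that f gC]
      by (simp add: less_imp_le)
    show "\<exists>r>0. \<forall>\<psi>\<in>states X. connes_dist X \<mu> \<phi> \<psi> < r \<longrightarrow> \<psi> \<in> {\<phi> \<in> states X. \<phi> f \<in> V}"
    proof (intro exI[of _ "ennreal (e / (4 * K))"] conjI ballI impI)
      show "ennreal (e / (4 * K)) > 0" using e K by simp
      fix \<psi> assume \<psi>: "\<psi> \<in> states X" "connes_dist X \<mu> \<phi> \<psi> < ennreal (e / (4 * K))"
      have "cmod (\<phi> g - \<psi> g) \<le> e / 4" using K(2)[OF \<phi>(1) \<psi>] K(1) by simp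
      moreover have "\<psi> f - \<phi> f = (\<psi> f - \<psi> g) - (\<phi> g - \<psi> g) - (\<phi> f - \<phi> g)" by simp
      then have "cmod (\<psi> f - \<phi> f) \<le> cmod (\<psi> f - \<psi> g) + cmod (\<phi> g - \<psi> g) + cmod (\<phi> f - \<phi> g)"
        by (simp only:) (rule order_trans[OF norm_triangle_ineq4 add_right_mono[OF norm_triangle_ineq4]])
      ultimately have "dist (\<psi> f) (\<phi> f) < e"
        using close[OF \<phi>(1)] close[OF \<psi>(1)] e(1) by (simp add: dist_norm)
      with \<psi> e(2) show "\<psi> \<in> {\<phi> \<in> states X. \<phi> f \<in> V}" by simp
    qed
  qed auto
qed

end


section \<open>Lipschitz functions under a polynomial lower bound on cylinders\<close>

locale polynomial_subshift = measured_subshift +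
  fixes C s :: real
  assumes C: "C > 0" and s: "s < 2"
    and cyl_lower: "n \<ge> 1 \<Longrightarrow> w \<in> words X n \<Longrightarrow> C * real n powr (- s) \<le> measure \<mu> (cyl X w)"
begin

text \<open>From \<open>j\<close> to \<open>j + 1\<close>, the average over cylinders of length \<open>2\<^sup>j\<close> of a function with commutator
  norm at most one moves by at most \<open>step_bound * ratio ^ j\<close>. The norm in \<open>L\<^sup>2\<close> of the change is at most
  \<open>2\<close> to the power \<open>-j\<close>, and passing to the sup norm costs the factor
  \<open>(C * (2 * 2\<^sup>j) powr (-s)) powr (-1/2)\<close>, which is \<open>step_bound * (2\<^sup>j) powr (s/2)\<close>. The ratio is less
  than one exactly because \<open>s < 2\<close>.\<close>

definition ratio :: real where "ratio = 2 powr (s / 2 - 1)"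

definition step_bound :: real where "step_bound = sqrt (2 powr s / C)"

lemma ratio: "0 < ratio" "ratio < 1"
  using s powr_less_mono[of "s / 2 - 1" 0 2] by (auto simp: ratio_def)

lemma step_bound_pos: "step_bound > 0" using C by (simp add: step_bound_def)

lemma dyadic_step:
  assumes f: "f \<in> Cinf X" and le: "commutator_norm X \<mu> f \<le> 1"
  shows "cmod (average (2 ^ Suc j) f x - average (2 ^ j) f x) \<le> step_bound * ratio ^ j"
proof (cases "x \<in> X")
  case True
  define g where "g = (\<lambda>x. average (2 ^ Suc j) f x - average (2 ^ j) f x)"
  have g: "g \<in> Cn X (2 ^ Suc j)"
    unfolding g_def by (intro Cn_diff average_Cn Cn_mono[OF average_Cn[of "2 ^ j"]]) simp
  define N where "N = (2::real) ^ j"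
  have N: "N > 0" by (simp add: N_def)
  have "(cmod (g x))\<^sup>2 * (C * (2 * N) powr (- s)) \<le> (cmod (g x))\<^sup>2 * measure \<mu> (cyl X (map x (window (2 ^ Suc j))))"
    using cyl_lower[OF _ word_in[OF True, of "2 ^ Suc j"]]
    by (intro mult_left_mono) (auto simp: N_def)
  also have "\<dots> \<le> sqnorm g" by (rule sup_le_sqnorm[OF g True])
  finally have 1: "(cmod (g x))\<^sup>2 * (C * (2 * N) powr (- s)) \<le> sqnorm g" .
  have "N\<^sup>2 * sqnorm g \<le> (real (Suc (2 ^ j)))\<^sup>2 * sqnorm g"
    by (intro mult_right_mono power_mono) (auto simp: N_def)
  also have "\<dots> \<le> 1" unfolding g_def by (rule commutator_le_1_average[OF f le]) simp
  finally have "sqnorm g \<le> 1 / N\<^sup>2" using N by (simp add: field_simps)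
  with 1 have "(cmod (g x))\<^sup>2 * (C * (2 * N) powr (- s)) \<le> 1 / N\<^sup>2" by linarith
  then have "(cmod (g x))\<^sup>2 \<le> (2 * N) powr s / (C * N\<^sup>2)"
    using N C by (simp add: powr_minus field_simps)
  also have "\<dots> = (step_bound * ratio ^ j)\<^sup>2"
  proof -
    have "(ratio ^ j)\<^sup>2 = N powr s / N\<^sup>2"
    proof -
      have "(ratio ^ j)\<^sup>2 = 2 powr ((s / 2 - 1) * real j * 2)"
        by (simp add: ratio_def powr_power powr_powr power_mult[symmetric] mult_ac)
      also have "(s / 2 - 1) * real j * 2 = real j * s - real (2 * j)" by (simp add: field_simps)
      also have "2 powr \<dots> = 2 powr (real j * s) / 2 powr real (2 * j)" by (rule powr_diff)
      also have "2 powr real (2 * j) = N\<^sup>2"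
        unfolding N_def by (subst powr_realpow) (simp_all add: power_mult[symmetric] mult.commute)
      also have "2 powr (real j * s) = N powr s"
        unfolding N_def by (subst powr_realpow[symmetric]) (simp_all only: powr_powr zero_less_numeral)
      finally show ?thesis .
    qed
    then show ?thesis
      using C N by (simp add: step_bound_def power_mult_distrib powr_mult)
  qed
  finally have "cmod (g x) \<le> step_bound * ratio ^ j"
    using step_bound_pos ratio by (simp add: power2_le_iff_abs_le)
  then show ?thesis by (simp add: g_def)
next
  case False
  then show ?thesis using Cn_off[OF average_Cn] step_bound_pos ratio by simp
qed

text \<open>The steps from \<open>k\<close> on add up to the tail of a geometric series, and they lead to \<open>f\<close> after
  finitely many steps because \<open>f\<close> is locally constant. The bound does not depend on \<open>f\<close>.\<close>

lemma uniform_approximation: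
  assumes f: "f \<in> Cinf X" and le: "commutator_norm X \<mu> f \<le> 1"
  shows "cmod (f x - average (2 ^ k) f x) \<le> step_bound * ratio ^ k / (1 - ratio)"
proof -
  obtain m where m: "f \<in> Cn X m" using f by (auto simp: Cinf_def)
  have "cmod (average (2 ^ (k + d)) f x - average (2 ^ k) f x) \<le> (\<Sum>i<d. step_bound * ratio ^ (k + i))" for d
  proof (induction d)
    case (Suc d)
    have "average (2 ^ (k + Suc d)) f x - average (2 ^ k) f x
        = (average (2 ^ Suc (k + d)) f x - average (2 ^ (k + d)) f x)
        + (average (2 ^ (k + d)) f x - average (2 ^ k) f x)" by simp
    also have "cmod \<dots> \<le> step_bound * ratio ^ (k + d) + (\<Sum>i<d. step_bound * ratio ^ (k + i))"
      by (rule norm_triangle_mono[OF dyadic_step[OF f le] Suc])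
    finally show ?case by simp
  qed simp
  moreover have "(\<Sum>i<d. step_bound * ratio ^ (k + i)) \<le> step_bound * ratio ^ k / (1 - ratio)" for d
  proof -
    have "(\<Sum>i<d. step_bound * ratio ^ (k + i)) = step_bound * ratio ^ k * (\<Sum>i<d. ratio ^ i)"
      by (simp add: sum_distrib_left power_add mult_ac)
    also have "(\<Sum>i<d. ratio ^ i) \<le> (\<Sum>i. ratio ^ i)"
      using ratio by (intro sum_le_suminf summable_geometric) auto
    also have "(\<Sum>i. ratio ^ i) = 1 / (1 - ratio)"
      using ratio by (intro suminf_geometric) auto
    finally show ?thesis using step_bound_pos ratio by (simp add: mult_left_mono)
  qed
  ultimately have "cmod (average (2 ^ (k + m)) f x - average (2 ^ k) f x) \<le> step_bound * ratio ^ k / (1 - ratio)"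
    by (rule order_trans)
  moreover have "m \<le> 2 ^ (k + m)"
    using less_exp[of "k + m"] by linarith
  then have "average (2 ^ (k + m)) f = f" by (intro average_id Cn_mono[OF m])
  ultimately show ?thesis by simp
qed

text \<open>The first summand bounds the distance from \<open>f\<close> to its average over cylinders of length \<open>1\<close>, the
  second one the distance from there to the constant function \<open>average 0 f\<close>.\<close>

definition radius :: real where "radius = step_bound / (1 - ratio) + 1 / sqrt C"

lemma radius_pos: "radius > 0"
  using step_bound_pos ratio C by (simp add: radius_def add_pos_pos)

lemma uniform_bound:
  assumes f: "f \<in> Cinf X" and le: "commutator_norm X \<mu> f \<le> 1"
  shows "cmod (f x - average 0 f x) \<le> radius"
proof (cases "x \<in> X")
  case True
  define g where "g = (\<lambda>x. average 1 f x - average 0 f x)"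
  have g: "g \<in> Cn X 1"
    unfolding g_def by (intro Cn_diff average_Cn Cn_mono[OF average_Cn[of 0]]) simp
  have "(cmod (g x))\<^sup>2 * C \<le> (cmod (g x))\<^sup>2 * measure \<mu> (cyl X (map x (window 1)))"
    using cyl_lower[OF _ word_in[OF True, of 1]] by (intro mult_left_mono) auto
  also have "\<dots> \<le> sqnorm g" by (rule sup_le_sqnorm[OF g True])
  also have "\<dots> \<le> 1" using commutator_le_1_average[OF f le, of 0 1] by (simp add: g_def)
  finally have "(cmod (g x))\<^sup>2 \<le> (1 / sqrt C)\<^sup>2" using C by (simp add: field_simps)
  then have "cmod (g x) \<le> 1 / sqrt C"
    using C by (simp add: power2_le_iff_abs_le)
  moreover have "cmod (f x - average 1 f x) \<le> step_bound / (1 - ratio)"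
    using uniform_approximation[OF f le, of x 0] by simp
  ultimately have "cmod ((f x - average 1 f x) + g x) \<le> step_bound / (1 - ratio) + 1 / sqrt C"
    by (rule norm_triangle_mono[rotated])
  then show ?thesis by (simp add: g_def radius_def)
next
  case False
  obtain m where m: "f \<in> Cn X m" using f by (auto simp: Cinf_def)
  show ?thesis using radius_pos Cn_off[OF m False] Cn_off[OF average_Cn False] by simp
qed

lemma average_0: "\<exists>a. average 0 f = (\<lambda>x. a * indicator X x)"
  using average_Cn[of 0 f] by (auto simp: Cn_def)

lemma state_const: "\<phi> \<in> states X \<Longrightarrow> \<psi> \<in> states X \<Longrightarrow> \<phi> (average 0 f) = \<psi> (average 0 f)"
  using average_0[of f] state_cmult[OF _ indicator_X_CX] state_one by metis

text \<open>Two states agree on constants, and modulo constants the functions with commutator norm at most one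
  form a bounded set.\<close>

lemma finite_metric: "finite_connes_metric X \<mu>"
  unfolding finite_connes_metric_def
proof (intro ballI)
  fix \<phi> \<psi> assume st: "\<phi> \<in> states X" "\<psi> \<in> states X"
  have "connes_dist X \<mu> \<phi> \<psi> \<le> ennreal (4 * radius)"
    unfolding connes_dist_def
  proof (rule SUP_least, clarify, rule ennreal_leI)
    fix f assume f: "f \<in> Cinf X" and le: "commutator_norm X \<mu> f \<le> 1"
    then have fC: "f \<in> CX X" using Cn_CX by (auto simp: Cinf_def)
    note aC = Cn_CX[OF average_Cn[of 0 f]]
    have b: "cmod (\<omega> f - \<omega> (average 0 f)) \<le> 2 * radius" if "\<omega> \<in> states X" for \<omega>
      using state_bound[OF that CX_diff[OF fC aC] uniform_bound[OF f le]] state_diff[OF that fC aC] by simp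
    have "\<phi> f - \<psi> f = (\<phi> f - \<phi> (average 0 f)) - (\<psi> f - \<psi> (average 0 f))"
      using state_const[OF st] by simp
    also have "cmod \<dots> \<le> 2 * radius + 2 * radius"
      by (rule order_trans[OF norm_triangle_ineq4 add_mono[OF b[OF st(1)] b[OF st(2)]]])
    finally show "cmod (\<phi> f - \<psi> f) \<le> 4 * radius" by simp
  qed
  then show "connes_dist X \<mu> \<phi> \<psi> < \<infinity>" by (rule le_less_trans) simp
qed

text \<open>Up to a uniformly small error, all functions with commutator norm at most one lie in one space
  \<open>C\<^sub>n\<close>. There they are combinations of finitely many characteristic functions of cylinders, with
  bounded coefficients after a constant is subtracted. States that are close on these finitely many
  functions are therefore close for the Connes metric.\<close>

lemma connes_dist_small:
  assumes \<phi>: "\<phi> \<in> states X" and e: "e > 0"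
  obtains n d where "d > 0" "\<And>\<psi>. \<psi> \<in> states X \<Longrightarrow>
    (\<And>w. w \<in> words X n \<Longrightarrow> cmod (\<phi> (indicator (cyl X w)) - \<psi> (indicator (cyl X w))) < d) \<Longrightarrow>
    connes_dist X \<mu> \<phi> \<psi> \<le> ennreal e"
proof -
  have "(\<lambda>k. step_bound * ratio ^ k / (1 - ratio)) \<longlonglongrightarrow> step_bound * 0 / (1 - ratio)"
    using ratio by (intro tendsto_intros LIMSEQ_realpow_zero) auto
  then have "\<forall>\<^sub>F k in sequentially. step_bound * ratio ^ k / (1 - ratio) < e / 8"
    using e by (intro order_tendstoD) auto
  then obtain k where k: "step_bound * ratio ^ k / (1 - ratio) < e / 8"
    by (auto simp: eventually_sequentially)
  define n where "n = (2::nat) ^ k"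
  define M where "M = e / 8 + radius"
  have M: "M > 0" using e radius_pos by (simp add: M_def)
  define q where "q = real (card (words X n)) + 1"
  have q: "q > 0" by (simp add: q_def add_nonneg_pos)
  define d where "d = e / (2 * M * q)"
  have d: "d > 0" using e M q by (simp add: d_def)
  have "connes_dist X \<mu> \<phi> \<psi> \<le> ennreal e"
    if \<psi>: "\<psi> \<in> states X" and near: "\<And>w. w \<in> words X n \<Longrightarrow>
      cmod (\<phi> (indicator (cyl X w)) - \<psi> (indicator (cyl X w))) < d" for \<psi>
    unfolding connes_dist_def
  proof (rule SUP_least, clarify, rule ennreal_leI)
    fix f assume f: "f \<in> Cinf X" and le: "commutator_norm X \<mu> f \<le> 1"
    then have fC: "f \<in> CX X" using Cn_CX by (auto simp: Cinf_def)
    have aC: "average i f \<in> CX X" for i by (rule Cn_CX[OF average_Cn])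
    have app: "cmod (f x - average n f x) \<le> e / 8" for x
      using uniform_approximation[OF f le, of x k] k unfolding n_def by linarith
    have b: "cmod (\<omega> f - \<omega> (average n f)) \<le> e / 4" if "\<omega> \<in> states X" for \<omega>
      using state_bound[OF that CX_diff[OF fC aC] app] state_diff[OF that fC aC] by simp
    define g where "g = (\<lambda>x. average n f x - average 0 f x)"
    have g: "g \<in> Cn X n"
      unfolding g_def by (intro Cn_diff average_Cn Cn_mono[OF average_Cn[of 0]]) simp
    have gM: "cmod (g x) \<le> M" for x
    proof -
      have "g x = (f x - average 0 f x) - (f x - average n f x)" by (simp add: g_def)
      then show ?thesis
        using norm_triangle_ineq4[of "f x - average 0 f x" "f x - average n f x"]
          uniform_bound[OF f le, of x] app[of x] by (simp add: M_def)
    qed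
    obtain c where c: "g = (\<lambda>x. \<Sum>w\<in>words X n. c w * indicator (cyl X w) x)"
      using g by (auto simp: Cn_words)
    have cM: "cmod (c w) \<le> M" if w: "w \<in> words X n" for w
    proof -
      obtain x where "x \<in> X" "w = map x (window n)" using w unfolding words_window by blast
      then have "g x = c w" unfolding c sum_words_indicator by simp
      with gM[of x] show ?thesis by simp
    qed
    have gs: "\<omega> g = (\<Sum>w\<in>words X n. c w * \<omega> (indicator (cyl X w)))" if "\<omega> \<in> states X" for \<omega>
      unfolding c using state_sum[OF that finite_words, of n "\<lambda>w. indicator (cyl X w)" c]
        Cn_CX[OF indicator_cyl_Cn] by blast
    have "\<phi> g - \<psi> g = (\<Sum>w\<in>words X n. c w * (\<phi> (indicator (cyl X w)) - \<psi> (indicator (cyl X w))))"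
      by (simp add: gs[OF \<phi>] gs[OF \<psi>] sum_subtractf right_diff_distrib)
    also have "cmod \<dots> \<le> (\<Sum>w\<in>words X n. M * d)"
    proof (rule sum_norm_le)
      fix w assume w: "w \<in> words X n"
      show "cmod (c w * (\<phi> (indicator (cyl X w)) - \<psi> (indicator (cyl X w)))) \<le> M * d"
        unfolding norm_mult using cM[OF w] near[OF w] M by (intro mult_mono) auto
    qed
    also have "\<dots> \<le> q * (M * d)" using M d by (simp add: q_def)
    also have "\<dots> = e / 2" using M q by (simp add: d_def field_simps)
    finally have 1: "cmod (\<phi> g - \<psi> g) \<le> e / 2" .
    have "\<phi> (average n f) - \<psi> (average n f) = \<phi> g - \<psi> g"
      unfolding g_def state_diff[OF \<phi> aC aC] state_diff[OF \<psi> aC aC]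
      using state_const[OF \<phi> \<psi>] by simp
    then have "\<phi> f - \<psi> f = (\<phi> f - \<phi> (average n f)) - (\<psi> f - \<psi> (average n f)) + (\<phi> g - \<psi> g)"
      by (simp add: algebra_simps)
    then have "cmod (\<phi> f - \<psi> f) \<le> cmod (\<phi> f - \<phi> (average n f)) + cmod (\<psi> f - \<psi> (average n f)) + cmod (\<phi> g - \<psi> g)"
      by (simp only:) (rule order_trans[OF norm_triangle_ineq add_right_mono[OF norm_triangle_ineq4]])
    with 1 b[OF \<phi>] b[OF \<psi>] show "cmod (\<phi> f - \<psi> f) \<le> e" by linarith
  qed
  with d that show ?thesis by blast
qed

text \<open>One inclusion of topologies is the continuity of the evaluations at continuous functions; the other
  one holds because each ball of the Connes metric contains a neighbourhood given by finitely many
  evaluations at cylinder functions.\<close>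

theorem connes_topology_eq_weak_star: "connes_topology X \<mu> = weak_star X"
proof (rule topology_eq[THEN iffD2], intro allI iffI)
  have tw: "topspace (weak_star X) = states X"
    by (auto simp: weak_star_def states_def PiE_def)
  fix U
  {
    assume U: "openin (connes_topology X \<mu>) U"
    show "openin (weak_star X) U"
    proof (subst openin_subopen, intro ballI)
      fix \<phi> assume "\<phi> \<in> U"
      with U obtain r where \<phi>: "\<phi> \<in> states X" and r: "r > 0"
        "\<And>\<psi>. \<psi> \<in> states X \<Longrightarrow> connes_dist X \<mu> \<phi> \<psi> < r \<Longrightarrow> \<psi> \<in> U"
        unfolding openin_connes_topology by blast
      obtain e where e: "e > 0" "ennreal e < r"
      proof -
        obtain t where t: "0 < t" "t < r" using dense[OF r(1)] by blast
        then have "ennreal (enn2real t) = t" by (intro ennreal_enn2real) (rule order.strict_trans2[OF t(2) top_greatest])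
        with t that[of "enn2real t"] show ?thesis
          by (metis ennreal_0 ennreal_less_zero_iff enn2real_nonneg less_le)
      qed
      obtain n d where d: "d > 0" "\<And>\<psi>. \<psi> \<in> states X \<Longrightarrow>
          (\<And>w. w \<in> words X n \<Longrightarrow> cmod (\<phi> (indicator (cyl X w)) - \<psi> (indicator (cyl X w))) < d) \<Longrightarrow>
          connes_dist X \<mu> \<phi> \<psi> \<le> ennreal e"
        using connes_dist_small[OF \<phi> e(1)] by metis
      let ?T = "topspace (weak_star X) \<inter> (\<Inter>w\<in>words X n. {\<psi> \<in> topspace (weak_star X).
        \<psi> (indicator (cyl X w)) \<in> ball (\<phi> (indicator (cyl X w))) d})"
      have "openin (weak_star X) {\<psi> \<in> topspace (weak_star X).
          \<psi> (indicator (cyl X w)) \<in> ball (\<phi> (indicator (cyl X w))) d}" if w: "w \<in> words X n" for w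
      proof (rule openin_continuous_map_preimage)
        show "continuous_map (weak_star X) euclidean (\<lambda>\<psi>. \<psi> (indicator (cyl X w) :: biword \<Rightarrow> complex))"
          unfolding weak_star_def
          by (intro continuous_map_from_subtopology continuous_map_product_projection Cn_CX[OF indicator_cyl_Cn[OF w]])
      qed simp
      then have "openin (weak_star X) ?T"
        by (cases "words X n = {}") (auto intro!: openin_Int openin_INT finite_words simp del: mem_ball)
      moreover have "\<phi> \<in> ?T" using \<phi> d(1) by (simp add: tw)
      moreover have "?T \<subseteq> U"
      proof
        fix \<psi> assume \<psi>: "\<psi> \<in> ?T"
        then have "\<psi> \<in> states X" by (simp add: tw)
        moreover have "connes_dist X \<mu> \<phi> \<psi> \<le> ennreal e"
          using \<psi> by (intro d(2)) (auto simp: tw dist_norm)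
        ultimately show "\<psi> \<in> U" using r(2) e(2) by (meson le_less_trans)
      qed
      ultimately show "\<exists>T. openin (weak_star X) T \<and> \<phi> \<in> T \<and> T \<subseteq> U" by blast
    qed
  next
    assume U: "openin (weak_star X) U"
    then obtain V where V: "openin (product_topology (\<lambda>_. euclidean) (CX X)) V" "U = V \<inter> states X"
      by (auto simp: weak_star_def openin_subtopology)
    have "continuous_map (connes_topology X \<mu>) (product_topology (\<lambda>_. euclidean) (CX X)) (\<lambda>\<phi>. \<phi>)"
      unfolding continuous_map_componentwise using connes_continuous_eval
      by (auto simp: topspace_connes_topology states_def)
    from openin_continuous_map_preimage[OF this V(1)]
    have "openin (connes_topology X \<mu>) {\<phi> \<in> topspace (connes_topology X \<mu>). \<phi> \<in> V}" .
    moreover have "{\<phi> \<in> topspace (connes_topology X \<mu>). \<phi> \<in> V} = U"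
      using V(2) by (auto simp: topspace_connes_topology)
    ultimately show "openin (connes_topology X \<mu>) U" by simp
  }
qed

end


section \<open>Sturmian words as differences of integer parts\<close>

text \<open>Whether \<open>frac u\<close> lies in \<open>[0, 1 - \<theta>)\<close> is decided by whether \<open>u\<close> and \<open>u + \<theta>\<close> have the same integer
  part; for \<open>(0, 1 - \<theta>]\<close> the integer part is replaced by the ceiling. The digits of a Sturmian word
  thus record the increments of the integer parts along an arithmetic progression.\<close>

definition floor_word :: "real \<Rightarrow> real \<Rightarrow> biword" where
  "floor_word \<theta> x = (\<lambda>n. if \<lfloor>of_int (n + 1) * \<theta> - x\<rfloor> = \<lfloor>of_int n * \<theta> - x\<rfloor> then 0 else 1)"

definition ceil_word :: "real \<Rightarrow> real \<Rightarrow> biword" where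
  "ceil_word \<theta> x = (\<lambda>n. if \<lceil>of_int (n + 1) * \<theta> - x\<rceil> = \<lceil>of_int n * \<theta> - x\<rceil> then 0 else 1)"

lemma frac_floor_iff:
  fixes \<theta> u :: real
  assumes "0 < \<theta>" "\<theta> < 1"
  shows "frac u \<in> {0..<1-\<theta>} \<longleftrightarrow> \<lfloor>u + \<theta>\<rfloor> = \<lfloor>u\<rfloor>"
  using assms floor_correct[of u]
  by (auto simp: frac_def floor_eq_iff; linarith)

lemma frac_ceil_iff:
  fixes \<theta> u :: real
  assumes "0 < \<theta>" "\<theta> < 1"
  shows "frac u \<in> {0<..1-\<theta>} \<longleftrightarrow> \<lceil>u + \<theta>\<rceil> = \<lceil>u\<rceil>"
proof (cases "u \<in> \<int>")
  case True
  then show ?thesis using assms by (auto simp: ceiling_eq_iff frac_def elim!: Ints_cases)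
next
  case False
  then have ne: "u \<noteq> of_int \<lfloor>u\<rfloor>" by (metis Ints_of_int)
  then have c: "\<lceil>u\<rceil> = \<lfloor>u\<rfloor> + 1" by (simp add: ceiling_altdef)
  have "of_int \<lfloor>u\<rfloor> < u" using ne floor_correct[of u] by linarith
  then show ?thesis using assms unfolding c by (auto simp: ceiling_eq_iff frac_def)
qed

lemma sturmian_eq:
  assumes \<theta>: "0 < \<theta>" "\<theta> < 1"
  shows "sturmian \<theta> = range (floor_word \<theta>) \<union> range (ceil_word \<theta>)"
proof -
  have 1: "frac (of_int n * \<theta> - x) \<in> {0..<1-\<theta>} \<longleftrightarrow> \<lfloor>of_int (n + 1) * \<theta> - x\<rfloor> = \<lfloor>of_int n * \<theta> - x\<rfloor>" for n x
    using frac_floor_iff[OF \<theta>, of "of_int n * \<theta> - x"] by (simp add: algebra_simps)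
  have 2: "frac (of_int n * \<theta> - x) \<in> {0<..1-\<theta>} \<longleftrightarrow> \<lceil>of_int (n + 1) * \<theta> - x\<rceil> = \<lceil>of_int n * \<theta> - x\<rceil>" for n x
    using frac_ceil_iff[OF \<theta>, of "of_int n * \<theta> - x"] by (simp add: algebra_simps)
  have "sturmian \<theta> = {w. \<exists>x. (\<forall>n. w n = floor_word \<theta> x n) \<or> (\<forall>n. w n = ceil_word \<theta> x n)}"
    unfolding sturmian_def bex_simps(1) bex_empty simp_thms insert_iff 
    by (simp only: bex_simps 1 2 floor_word_def ceil_word_def simp_thms)
  then show ?thesis by (auto simp: fun_eq_iff image_iff)
qed

lemma floor_word_int: "floor_word \<theta> (x + of_int m) = floor_word \<theta> x"
proof -
  have "\<lfloor>a - (x + of_int m)\<rfloor> = \<lfloor>a - x\<rfloor> - m" for a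
    using floor_diff_of_int[of "a - x" m] by (simp add: algebra_simps)
  then show ?thesis by (simp add: floor_word_def)
qed

lemma ceil_word_int: "ceil_word \<theta> (x + of_int m) = ceil_word \<theta> x"
proof -
  have "\<lceil>a - (x + of_int m)\<rceil> = \<lceil>a - x\<rceil> - m" for a
    using ceiling_diff_of_int[of "a - x" m] by (simp add: algebra_simps)
  then show ?thesis by (simp add: ceil_word_def)
qed

lemma shift_floor_word: "(shift ^^ j) (floor_word \<theta> x) = floor_word \<theta> (x - real j * \<theta>)"
  by (auto simp: shift_funpow floor_word_def algebra_simps)

lemma shift_ceil_word: "(shift ^^ j) (ceil_word \<theta> x) = ceil_word \<theta> (x - real j * \<theta>)"
  by (auto simp: shift_funpow ceil_word_def algebra_simps)

lemma shift_sturmian: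
  assumes \<theta>: "0 < \<theta>" "\<theta> < 1"
  shows "shift ` sturmian \<theta> = sturmian \<theta>"
proof -
  have f: "shift (floor_word \<theta> x) = floor_word \<theta> (x - \<theta>)" for x
    using shift_floor_word[of 1 \<theta> x] by simp
  have c: "shift (ceil_word \<theta> x) = ceil_word \<theta> (x - \<theta>)" for x
    using shift_ceil_word[of 1 \<theta> x] by simp
  have "y \<in> range (\<lambda>x. x - \<theta>)" for y by (rule range_eqI[of _ _ "y + \<theta>"]) simp
  then have s: "range (\<lambda>x. x - \<theta>) = UNIV" by blast
  have "shift ` range (floor_word \<theta>) = floor_word \<theta> ` range (\<lambda>x. x - \<theta>)"
    by (simp only: image_image f)
  moreover have "shift ` range (ceil_word \<theta>) = ceil_word \<theta> ` range (\<lambda>x. x - \<theta>)"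
    by (simp only: image_image c)
  ultimately show ?thesis unfolding sturmian_eq[OF \<theta>] image_Un s by simp
qed


section \<open>Compactness of the Sturmian subshift\<close>

lemma eventually_floor_right:
  fixes y :: real
  assumes "(f \<longlongrightarrow> y) F" "\<And>j. f j \<ge> y"
  shows "\<forall>\<^sub>F j in F. \<lfloor>f j\<rfloor> = \<lfloor>y\<rfloor>"
proof -
  have "\<forall>\<^sub>F j in F. f j < of_int \<lfloor>y\<rfloor> + 1"
    by (rule order_tendstoD(2)[OF assms(1)]) linarith
  then show ?thesis
  proof eventually_elim
    case (elim j)
    then show ?case using assms(2)[of j] floor_correct[of y] by (intro floor_unique) linarith+
  qed
qed

lemma eventually_floor_left:
  fixes y :: real
  assumes "(f \<longlongrightarrow> y) F" "\<And>j. f j < y"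
  shows "\<forall>\<^sub>F j in F. \<lfloor>f j\<rfloor> = \<lceil>y\<rceil> - 1"
proof -
  have "\<forall>\<^sub>F j in F. f j > of_int \<lceil>y\<rceil> - 1"
    by (rule order_tendstoD(1)[OF assms(1)]) linarith
  then show ?thesis
  proof eventually_elim
    case (elim j)
    then show ?case using assms(2)[of j] ceiling_correct[of y] by (intro floor_unique) linarith+
  qed
qed

lemma eventually_ceiling_left:
  fixes y :: real
  assumes "(f \<longlongrightarrow> y) F" "\<And>j. f j \<le> y"
  shows "\<forall>\<^sub>F j in F. \<lceil>f j\<rceil> = \<lceil>y\<rceil>"
proof -
  have "\<forall>\<^sub>F j in F. f j > of_int \<lceil>y\<rceil> - 1"
    by (rule order_tendstoD(1)[OF assms(1)]) linarith
  then show ?thesis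
  proof eventually_elim
    case (elim j)
    then show ?case using assms(2)[of j] ceiling_correct[of y] by (intro ceiling_unique) linarith+
  qed
qed

lemma eventually_ceiling_right:
  fixes y :: real
  assumes "(f \<longlongrightarrow> y) F" "\<And>j. f j > y"
  shows "\<forall>\<^sub>F j in F. \<lceil>f j\<rceil> = \<lfloor>y\<rfloor> + 1"
proof -
  have "\<forall>\<^sub>F j in F. f j < of_int \<lfloor>y\<rfloor> + 1"
    by (rule order_tendstoD(2)[OF assms(1)]) linarith
  then show ?thesis
  proof eventually_elim
    case (elim j)
    then show ?case using assms(2)[of j] floor_correct[of y] by (intro ceiling_unique) linarith+
  qed
qed

text \<open>As \<open>x j\<close> tends to \<open>t\<close> from one side, each integer part in the definition of the words has a
  one-sided limit. Approached from below, integer parts tend to the ceiling minus one, and ceilings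
  approached from above to the integer part plus one; the increments are those of a word of the other
  kind. So the two kinds of words are limits of each other.\<close>

lemma word_limits:
  assumes x: "x \<longlonglongrightarrow> t"
  shows "(\<And>j. x j \<le> t) \<Longrightarrow> (\<lambda>j. floor_word \<theta> (x j)) \<longlonglongrightarrow> floor_word \<theta> t"
    and "(\<And>j. x j > t) \<Longrightarrow> (\<lambda>j. floor_word \<theta> (x j)) \<longlonglongrightarrow> ceil_word \<theta> t"
    and "(\<And>j. x j \<ge> t) \<Longrightarrow> (\<lambda>j. ceil_word \<theta> (x j)) \<longlonglongrightarrow> ceil_word \<theta> t"
    and "(\<And>j. x j < t) \<Longrightarrow> (\<lambda>j. ceil_word \<theta> (x j)) \<longlonglongrightarrow> floor_word \<theta> t"
proof -
  have y: "(\<lambda>j. of_int k * \<theta> - x j) \<longlonglongrightarrow> of_int k * \<theta> - t" for k :: int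
    by (intro tendsto_intros x)
  show "(\<lambda>j. floor_word \<theta> (x j)) \<longlonglongrightarrow> floor_word \<theta> t" if "\<And>j. x j \<le> t"
    unfolding tendsto_biword_iff
  proof
    fix i
    have e: "\<forall>\<^sub>F j in sequentially. \<lfloor>of_int k * \<theta> - x j\<rfloor> = \<lfloor>of_int k * \<theta> - t\<rfloor>" for k
      using that by (intro eventually_floor_right[OF y]) simp
    show "\<forall>\<^sub>F j in sequentially. floor_word \<theta> (x j) i = floor_word \<theta> t i"
      using e[of i] e[of "i + 1"] by eventually_elim (simp add: floor_word_def)
  qed
  show "(\<lambda>j. floor_word \<theta> (x j)) \<longlonglongrightarrow> ceil_word \<theta> t" if "\<And>j. x j > t"
    unfolding tendsto_biword_iff
  proof
    fix i
    have e: "\<forall>\<^sub>F j in sequentially. \<lfloor>of_int k * \<theta> - x j\<rfloor> = \<lceil>of_int k * \<theta> - t\<rceil> - 1" for k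
      using that by (intro eventually_floor_left[OF y]) simp
    show "\<forall>\<^sub>F j in sequentially. floor_word \<theta> (x j) i = ceil_word \<theta> t i"
      using e[of i] e[of "i + 1"] by eventually_elim (simp add: floor_word_def ceil_word_def)
  qed
  show "(\<lambda>j. ceil_word \<theta> (x j)) \<longlonglongrightarrow> ceil_word \<theta> t" if "\<And>j. x j \<ge> t"
    unfolding tendsto_biword_iff
  proof
    fix i
    have e: "\<forall>\<^sub>F j in sequentially. \<lceil>of_int k * \<theta> - x j\<rceil> = \<lceil>of_int k * \<theta> - t\<rceil>" for k
      using that by (intro eventually_ceiling_left[OF y]) simp
    show "\<forall>\<^sub>F j in sequentially. ceil_word \<theta> (x j) i = ceil_word \<theta> t i"
      using e[of i] e[of "i + 1"] by eventually_elim (simp add: ceil_word_def)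
  qed
  show "(\<lambda>j. ceil_word \<theta> (x j)) \<longlonglongrightarrow> floor_word \<theta> t" if "\<And>j. x j < t"
    unfolding tendsto_biword_iff
  proof
    fix i
    have e: "\<forall>\<^sub>F j in sequentially. \<lceil>of_int k * \<theta> - x j\<rceil> = \<lfloor>of_int k * \<theta> - t\<rfloor> + 1" for k
      using that by (intro eventually_ceiling_right[OF y]) simp
    show "\<forall>\<^sub>F j in sequentially. ceil_word \<theta> (x j) i = floor_word \<theta> t i"
      using e[of i] e[of "i + 1"] by eventually_elim (simp add: floor_word_def ceil_word_def)
  qed
qed

lemma subsequence_choice:
  assumes "infinite {k :: nat. P k}"
  obtains r where "strict_mono (r :: nat \<Rightarrow> nat)" "\<And>k. P (r k)"
  using infinite_enumerate[OF assms] by auto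

lemma bounded_parameters_converge:
  fixes x :: "nat \<Rightarrow> real"
  assumes "\<And>k. x k \<in> {0..1}"
  obtains t r where "strict_mono (r :: nat \<Rightarrow> nat)" "(x \<circ> r) \<longlonglongrightarrow> t" "\<forall>k. x (r k) < t"
  | t r where "strict_mono (r :: nat \<Rightarrow> nat)" "(x \<circ> r) \<longlonglongrightarrow> t" "\<forall>k. x (r k) = t"
  | t r where "strict_mono (r :: nat \<Rightarrow> nat)" "(x \<circ> r) \<longlonglongrightarrow> t" "\<forall>k. x (r k) > t"
proof -
  have "seq_compact {0..1::real}" by (simp add: seq_compact_eq_compact)
  then obtain t r where r: "strict_mono (r :: nat \<Rightarrow> nat)" "(x \<circ> r) \<longlonglongrightarrow> t"
    using assms unfolding seq_compact_def by metis
  have "(UNIV :: nat set) = {k. x (r k) < t} \<union> {k. x (r k) = t} \<union> {k. x (r k) > t}" by auto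
  then have "infinite {k. x (r k) < t} \<or> infinite {k. x (r k) = t} \<or> infinite {k. x (r k) > t}"
    by (metis finite_Un infinite_UNIV_nat)
  then obtain s where s: "strict_mono (s :: nat \<Rightarrow> nat)"
    "(\<forall>k. x (r (s k)) < t) \<or> (\<forall>k. x (r (s k)) = t) \<or> (\<forall>k. x (r (s k)) > t)"
    by (elim disjE; elim subsequence_choice) blast+
  have "(x \<circ> (r \<circ> s)) \<longlonglongrightarrow> t"
    using LIMSEQ_subseq_LIMSEQ[OF r(2) s(1)] by (simp add: o_assoc)
  moreover have "strict_mono (r \<circ> s)" using r(1) s(1) by (rule strict_mono_o)
  ultimately show thesis using s(2) that by (auto simp: o_def)
qed

text \<open>The parameter matters only modulo one. So it may be taken in a compact interval, and a subsequence of
  parameters is constant or converges from one fixed side.\<close>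

lemma compact_sturmian:
  assumes \<theta>: "0 < \<theta>" "\<theta> < 1"
  shows "compact (sturmian \<theta>)"
proof -
  have par: "floor_word \<theta> x = floor_word \<theta> (frac x)" "ceil_word \<theta> x = ceil_word \<theta> (frac x)" for x
    using floor_word_int[of \<theta> "frac x" "\<lfloor>x\<rfloor>"] ceil_word_int[of \<theta> "frac x" "\<lfloor>x\<rfloor>"] by (simp_all add: frac_def)
  have "\<exists>l\<in>sturmian \<theta>. \<exists>r. strict_mono r \<and> (w \<circ> r) \<longlonglongrightarrow> l" if w: "\<forall>k. w k \<in> sturmian \<theta>" for w :: "nat \<Rightarrow> biword"
  proof -
    have "(UNIV :: nat set) = {k. w k \<in> range (floor_word \<theta>)} \<union> {k. w k \<in> range (ceil_word \<theta>)}"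
      using w unfolding sturmian_eq[OF \<theta>] by auto
    then have "infinite {k. w k \<in> range (floor_word \<theta>)} \<or> infinite {k. w k \<in> range (ceil_word \<theta>)}"
      by (metis finite_Un infinite_UNIV_nat)
    then obtain r where r: "strict_mono (r :: nat \<Rightarrow> nat)"
      "(\<forall>k. w (r k) \<in> range (floor_word \<theta>)) \<or> (\<forall>k. w (r k) \<in> range (ceil_word \<theta>))"
      by (elim disjE; elim subsequence_choice) blast+
    have "\<exists>x. (\<forall>k. x k \<in> {0..1}) \<and>
      ((\<forall>k. w (r k) = floor_word \<theta> (x k)) \<or> (\<forall>k. w (r k) = ceil_word \<theta> (x k)))"
    proof -
      obtain x where x: "(\<forall>k. w (r k) = floor_word \<theta> (x k)) \<or> (\<forall>k. w (r k) = ceil_word \<theta> (x k))"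
      proof -
        from r(2) have "(\<forall>k. \<exists>x. w (r k) = floor_word \<theta> x) \<or> (\<forall>k. \<exists>x. w (r k) = ceil_word \<theta> x)"
          by blast
        then show thesis using that unfolding choice_iff by blast
      qed
      have "frac (x k) \<in> {0..1}" for k by (simp add: less_imp_le[OF frac_lt_1])
      with x show ?thesis by (intro exI[of _ "\<lambda>k. frac (x k)"]) (simp add: par[symmetric])
    qed
    then obtain x where x: "\<And>k. x k \<in> {0..1}" and
      wx: "(\<forall>k. w (r k) = floor_word \<theta> (x k)) \<or> (\<forall>k. w (r k) = ceil_word \<theta> (x k))" by blast
    have st: "floor_word \<theta> t \<in> sturmian \<theta>" "ceil_word \<theta> t \<in> sturmian \<theta>" for t
      by (auto simp: sturmian_eq[OF \<theta>])
    have main: ?thesis if s: "strict_mono s" and lim: "(x \<circ> s) \<longlonglongrightarrow> t"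
      and side: "(\<forall>k. x (s k) < t) \<or> (\<forall>k. x (s k) = t) \<or> (\<forall>k. x (s k) > t)" for s t
    proof -
      have "\<exists>l\<in>sturmian \<theta>. (\<lambda>k. w (r (s k))) \<longlonglongrightarrow> l"
        using wx side
      proof (elim disjE)
        assume "\<forall>k. w (r k) = floor_word \<theta> (x k)" "\<forall>k. x (s k) < t"
        then show ?thesis using word_limits(1)[OF lim, of \<theta>] st by (auto simp: less_imp_le)
      next
        assume "\<forall>k. w (r k) = floor_word \<theta> (x k)" "\<forall>k. x (s k) = t"
        then show ?thesis using word_limits(1)[OF lim, of \<theta>] st by auto
      next
        assume "\<forall>k. w (r k) = floor_word \<theta> (x k)" "\<forall>k. x (s k) > t"
        then show ?thesis using word_limits(2)[OF lim, of \<theta>] st by auto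
      next
        assume "\<forall>k. w (r k) = ceil_word \<theta> (x k)" "\<forall>k. x (s k) < t"
        then show ?thesis using word_limits(4)[OF lim, of \<theta>] st by auto
      next
        assume "\<forall>k. w (r k) = ceil_word \<theta> (x k)" "\<forall>k. x (s k) = t"
        then show ?thesis using word_limits(3)[OF lim, of \<theta>] st by auto
      next
        assume "\<forall>k. w (r k) = ceil_word \<theta> (x k)" "\<forall>k. x (s k) > t"
        then show ?thesis using word_limits(3)[OF lim, of \<theta>] st by (auto simp: less_imp_le)
      qed
      then show ?thesis using strict_mono_o[OF r(1) s] by (auto simp: o_def)
    qed
    show ?thesis
      by (rule bounded_parameters_converge[of x]) (use x main in blast)+
  qed
  then have "seq_compact (sturmian \<theta>)" by (simp add: seq_compact_def)
  then show ?thesis by (simp add: seq_compact_eq_compact)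
qed

lemma subshift_sturmian: "0 < \<theta> \<Longrightarrow> \<theta> < 1 \<Longrightarrow> subshift (sturmian \<theta>)"
  using compact_sturmian shift_sturmian by unfold_locales (auto simp: sturmian_eq)


section \<open>Recurrence of Sturmian words\<close>

lemma floor_constant:
  fixes \<alpha> t t' :: real
  assumes "t' \<le> t" "\<And>m :: int. \<not> (t' \<le> \<alpha> - of_int m \<and> \<alpha> - of_int m < t)"
  shows "\<lfloor>\<alpha> - t'\<rfloor> = \<lfloor>\<alpha> - t\<rfloor>"
  using assms(1) assms(2)[of "\<lfloor>\<alpha> - t'\<rfloor>"] floor_correct[of "\<alpha> - t'"]
  by (intro floor_unique[symmetric]) linarith+

lemma ceiling_constant:
  fixes \<alpha> t t' :: real
  assumes "t' \<le> t" "\<And>m :: int. \<not> (t' < \<alpha> - of_int m \<and> \<alpha> - of_int m \<le> t)"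
  shows "\<lceil>\<alpha> - t'\<rceil> = \<lceil>\<alpha> - t\<rceil>"
  using assms(1) assms(2)[of "\<lceil>\<alpha> - t\<rceil>"] ceiling_correct[of "\<alpha> - t"]
  by (intro ceiling_unique) linarith+

lemma ceiling_eq_floor:
  fixes \<alpha> t :: real
  assumes "\<And>m :: int. \<alpha> - of_int m \<noteq> t"
  shows "\<lceil>\<alpha> - t\<rceil> = \<lfloor>\<alpha> - t\<rfloor> + 1"
proof -
  have "\<alpha> - t \<noteq> of_int \<lfloor>\<alpha> - t\<rfloor>" using assms[of "\<lfloor>\<alpha> - t\<rfloor>"] by linarith
  then show ?thesis by (simp add: ceiling_altdef)
qed

text \<open>The entries of a Sturmian word in the block \<open>[a, a + n)\<close> change only when the parameter passes
  one of the points \<open>k\<theta> - m\<close> with \<open>a \<le> k \<le> a + n\<close>. These points have mutual distance at least \<open>\<delta>\<close>, so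
  every block is seen on a parameter interval of length \<open>\<delta>/2\<close>. Inside such an interval the two
  conventions for the end points give the same block.\<close>

lemma block_interval:
  fixes \<theta> \<delta> :: real and a :: int
  assumes \<theta>: "0 < \<theta>" "\<theta> < 1" and \<delta>: "0 < \<delta>" "\<delta> \<le> 1"
    and sep: "\<And>k m :: int. 0 < \<bar>k\<bar> \<Longrightarrow> \<bar>k\<bar> \<le> int n \<Longrightarrow> \<delta> \<le> \<bar>of_int k * \<theta> - of_int m\<bar>"
    and y: "y \<in> sturmian \<theta>"
  obtains u where "\<And>t i. u < t \<Longrightarrow> t < u + \<delta> / 2 \<Longrightarrow> a \<le> i \<Longrightarrow> i < a + int n \<Longrightarrow>
    floor_word \<theta> t i = y i \<and> ceil_word \<theta> t i = y i"
proof -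
  define bad where "bad b \<longleftrightarrow> (\<exists>k\<in>{a..a + int n}. \<exists>m::int. b = of_int k * \<theta> - of_int m)" for b :: real
  have apart: "\<delta> \<le> \<bar>b - b'\<bar>" if h: "bad b" "bad b'" "b \<noteq> b'" for b b'
  proof -
    obtain k m k' m' where k: "k \<in> {a..a + int n}" "b = of_int k * \<theta> - of_int m"
      and k': "k' \<in> {a..a + int n}" "b' = of_int k' * \<theta> - of_int m'"
      using h(1,2) unfolding bad_def by blast
    have d: "b - b' = of_int (k - k') * \<theta> - of_int (m - m')"
      by (simp add: k k' algebra_simps)
    show ?thesis
    proof (cases "k = k'")
      case True
      then have "m \<noteq> m'" using h(3) k k' by auto
      then have "1 \<le> \<bar>m - m'\<bar>" by linarith
      then have "1 \<le> \<bar>real_of_int (m - m')\<bar>" by linarith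
      then show ?thesis using \<delta> True unfolding d by simp
    next
      case False
      with k k' show ?thesis unfolding d by (intro sep) auto
    qed
  qed
  have fl: "\<lfloor>of_int k * \<theta> - t'\<rfloor> = \<lfloor>of_int k * \<theta> - t\<rfloor>"
    if "t' \<le> t" "\<And>b. t' \<le> b \<Longrightarrow> b < t \<Longrightarrow> \<not> bad b" "k \<in> {a..a + int n}" for k t t'
    using that unfolding bad_def by (intro floor_constant) blast+
  have ce: "\<lceil>of_int k * \<theta> - t'\<rceil> = \<lceil>of_int k * \<theta> - t\<rceil>"
    if "t' \<le> t" "\<And>b. t' < b \<Longrightarrow> b \<le> t \<Longrightarrow> \<not> bad b" "k \<in> {a..a + int n}" for k t t'
    using that unfolding bad_def by (intro ceiling_constant) blast+
  have cf: "\<lceil>of_int k * \<theta> - t\<rceil> = \<lfloor>of_int k * \<theta> - t\<rfloor> + 1"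
    if "\<not> bad t" "k \<in> {a..a + int n}" for k t
    using that unfolding bad_def by (intro ceiling_eq_floor) blast
  have fw: "floor_word \<theta> t i = floor_word \<theta> x i \<and> ceil_word \<theta> t i = floor_word \<theta> x i"
    if "\<not> bad t" "\<And>k. k \<in> {a..a + int n} \<Longrightarrow> \<lfloor>of_int k * \<theta> - t\<rfloor> = \<lfloor>of_int k * \<theta> - x\<rfloor>"
      "a \<le> i" "i < a + int n" for t x i
  proof -
    have i: "i \<in> {a..a + int n}" "i + 1 \<in> {a..a + int n}" using that by auto
    show ?thesis unfolding floor_word_def ceil_word_def
      using cf[OF that(1) i(1)] cf[OF that(1) i(2)] that(2)[OF i(1)] that(2)[OF i(2)] by simp
  qed
  have cw: "floor_word \<theta> t i = ceil_word \<theta> x i \<and> ceil_word \<theta> t i = ceil_word \<theta> x i"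
    if "\<not> bad t" "\<And>k. k \<in> {a..a + int n} \<Longrightarrow> \<lceil>of_int k * \<theta> - t\<rceil> = \<lceil>of_int k * \<theta> - x\<rceil>"
      "a \<le> i" "i < a + int n" for t x i
  proof -
    have i: "i \<in> {a..a + int n}" "i + 1 \<in> {a..a + int n}" using that by auto
    show ?thesis unfolding floor_word_def ceil_word_def
      using cf[OF that(1) i(1)] cf[OF that(1) i(2)] that(2)[OF i(1)] that(2)[OF i(2)] by simp
  qed
  consider x where "y = floor_word \<theta> x" | x where "y = ceil_word \<theta> x"
    using y unfolding sturmian_eq[OF \<theta>] by blast
  then show thesis
  proof cases
    case (1 x)
    \<comment> \<open>A floor word agrees on the block with those at parameters just below \<open>x\<close>. If a separating point
      \<open>b\<close> is too close on that side, then the next one is beyond \<open>b + \<delta>/2\<close>, and \<open>x\<close> is an interior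
      point of the interval from \<open>b\<close> to \<open>b + \<delta>/2\<close>.\<close>
    show thesis
    proof (cases "\<exists>b. x - \<delta> / 2 < b \<and> b < x \<and> bad b")
      case False
      show thesis
      proof (rule that[of "x - \<delta> / 2"])
        fix t i assume t: "x - \<delta> / 2 < t" "t < x - \<delta> / 2 + \<delta> / 2" and i: "a \<le> i" "i < a + int n"
        have "\<not> bad t" using False t by simp
        moreover have "\<lfloor>of_int k * \<theta> - t\<rfloor> = \<lfloor>of_int k * \<theta> - x\<rfloor>" if "k \<in> {a..a + int n}" for k
        proof (rule fl[OF _ _ that])
          show "\<not> bad b" if "t \<le> b" "b < x" for b using False t that less_le_trans by blast
        qed (use t in simp)
        ultimately show "floor_word \<theta> t i = y i \<and> ceil_word \<theta> t i = y i"
          unfolding 1 using i by (intro fw) auto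
      qed
    next
      case True
      then obtain b where b: "x - \<delta> / 2 < b" "b < x" "bad b" by blast
      have nb: "\<not> bad b'" if "b < b'" "b' < b + \<delta>" for b'
        using apart[OF _ b(3), of b'] that by auto
      show thesis
      proof (rule that[of b])
        fix t i assume t: "b < t" "t < b + \<delta> / 2" and i: "a \<le> i" "i < a + int n"
        have "\<not> bad t" using t \<delta> by (intro nb) auto
        moreover have "\<lfloor>of_int k * \<theta> - t\<rfloor> = \<lfloor>of_int k * \<theta> - x\<rfloor>" if k: "k \<in> {a..a + int n}" for k
        proof (cases "t \<le> x")
          case True
          show ?thesis
          proof (rule fl[OF True _ k])
            show "\<not> bad b'" if "t \<le> b'" "b' < x" for b' using t b \<delta> that by (intro nb) auto
          qed
        next
          case False
          have "\<lfloor>of_int k * \<theta> - x\<rfloor> = \<lfloor>of_int k * \<theta> - t\<rfloor>"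
          proof (rule fl[OF _ _ k])
            show "\<not> bad b'" if "x \<le> b'" "b' < t" for b' using t b \<delta> that by (intro nb) auto
          qed (use False in simp)
          then show ?thesis by simp
        qed
        ultimately show "floor_word \<theta> t i = y i \<and> ceil_word \<theta> t i = y i"
          unfolding 1 using i by (intro fw) auto
      qed
    qed
  next
    case (2 x)
    \<comment> \<open>The mirror image of the first case: ceiling words agree with those just above \<open>x\<close>.\<close>
    show thesis
    proof (cases "\<exists>b. x < b \<and> b < x + \<delta> / 2 \<and> bad b")
      case False
      show thesis
      proof (rule that[of x])
        fix t i assume t: "x < t" "t < x + \<delta> / 2" and i: "a \<le> i" "i < a + int n"
        have "\<not> bad t" using False t by simp
        moreover have "\<lceil>of_int k * \<theta> - t\<rceil> = \<lceil>of_int k * \<theta> - x\<rceil>" if "k \<in> {a..a + int n}" for k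
        proof (rule sym, rule ce[OF _ _ that])
          show "\<not> bad b" if "x < b" "b \<le> t" for b using False t that le_less_trans by blast
        qed (use t in simp)
        ultimately show "floor_word \<theta> t i = y i \<and> ceil_word \<theta> t i = y i"
          unfolding 2 using i by (intro cw) auto
      qed
    next
      case True
      then obtain b where b: "x < b" "b < x + \<delta> / 2" "bad b" by blast
      have nb: "\<not> bad b'" if "b - \<delta> < b'" "b' < b" for b'
        using apart[OF _ b(3), of b'] that by auto
      show thesis
      proof (rule that[of "b - \<delta> / 2"])
        fix t i assume t: "b - \<delta> / 2 < t" "t < b - \<delta> / 2 + \<delta> / 2" and i: "a \<le> i" "i < a + int n"
        have "\<not> bad t" using t \<delta> by (intro nb) auto
        moreover have "\<lceil>of_int k * \<theta> - t\<rceil> = \<lceil>of_int k * \<theta> - x\<rceil>" if k: "k \<in> {a..a + int n}" for k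
        proof (cases "t \<le> x")
          case True
          show ?thesis
          proof (rule ce[OF True _ k])
            show "\<not> bad b'" if "t < b'" "b' \<le> x" for b' using t b \<delta> that by (intro nb) auto
          qed
        next
          case False
          have "\<lceil>of_int k * \<theta> - x\<rceil> = \<lceil>of_int k * \<theta> - t\<rceil>"
          proof (rule ce[OF _ _ k])
            show "\<not> bad b'" if "x < b'" "b' \<le> t" for b' using t b \<delta> that by (intro nb) auto
          qed (use False in simp)
          then show ?thesis by simp
        qed
        ultimately show "floor_word \<theta> t i = y i \<and> ceil_word \<theta> t i = y i"
          unfolding 2 using i by (intro cw) auto
      qed
    qed
  qed
qed

text \<open>Up to an error \<open>1/q\<close>, the first \<open>q\<close> multiples of \<open>\<theta>\<close> modulo one are those of \<open>p/q\<close>, which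
  are equally spaced.\<close>

lemma orbit_dense:
  fixes \<theta> c :: real and p q :: int and Q :: nat
  assumes pq: "coprime p q" "0 < q" "q \<le> int Q" "\<bar>of_int q * \<theta> - of_int p\<bar> < 1 / real Q"
  obtains j :: nat and m :: int where "j < nat q" "\<bar>real j * \<theta> - of_int m - c\<bar> < 2 / of_int q"
proof -
  \<comment> \<open>The multiple \<open>l/q\<close> is next to \<open>c\<close>. Below, \<open>j\<close> solves \<open>j p \<equiv> l\<close> modulo \<open>q\<close>, so that \<open>j p/q\<close> is \<open>l/q\<close>
    modulo one.\<close>
  define l where "l = \<lfloor>of_int q * c\<rfloor>"
  obtain a b where ab: "a * p + b * q = 1"
    using bezout_int[of p q] pq(1) by (auto simp: coprime_iff_gcd_eq_1)
  define j where "j = (l * a) mod q"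
  have j: "0 \<le> j" "j < q" using pq(2) by (auto simp: j_def)
  define d where "d = (l * a) div q"
  define m where "m = - (l * b) - d * p"
  have "j * p = l + q * m"
  proof -
    have "j = l * a - d * q" by (simp add: j_def d_def minus_div_mult_eq_mod)
    then have "j * p = l * (a * p) - d * q * p" by (simp only: left_diff_distrib mult.assoc)
    also have "a * p = 1 - b * q" using ab by simp
    finally show ?thesis by (simp add: m_def algebra_simps)
  qed
  then have jp: "real_of_int j * of_int p = of_int l + of_int q * of_int m"
    by (metis of_int_add of_int_mult)
  define e where "e = of_int q * \<theta> - of_int p"
  have q0: "real_of_int q > 0" using pq(2) by simp
  have 1: "real_of_int j * \<theta> - of_int m = of_int l / of_int q + of_int j * e / of_int q"
  proof -
    have "of_int q * (real_of_int j * \<theta> - of_int m) = of_int l + of_int j * e"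
      using jp by (simp add: e_def algebra_simps)
    then show ?thesis using q0 by (simp add: field_simps)
  qed
  have 2: "\<bar>of_int l / of_int q - c\<bar> \<le> 1 / of_int q"
  proof -
    have "\<bar>of_int l - of_int q * c\<bar> \<le> 1" unfolding l_def by linarith
    moreover have "of_int l / of_int q - c = (of_int l - of_int q * c) / of_int q"
      using q0 by (simp add: field_simps)
    ultimately show ?thesis using q0 by (simp add: divide_right_mono)
  qed
  have 3: "\<bar>of_int j * e / of_int q\<bar> < 1 / of_int q"
  proof -
    have Q0: "real Q > 0" and qQ: "real_of_int q \<le> real Q" using pq by linarith+
    have "\<bar>of_int j * e\<bar> = of_int j * \<bar>e\<bar>" using j by (simp add: abs_mult)
    also have "\<dots> \<le> of_int q * \<bar>e\<bar>" using j by (intro mult_right_mono) auto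
    also have "\<dots> < of_int q * (1 / real Q)"
      using pq(4) q0 unfolding e_def by (intro mult_strict_left_mono) auto
    also have "\<dots> \<le> 1" using qQ Q0 by simp
    finally show ?thesis using q0 by (simp add: divide_strict_right_mono)
  qed
  have "\<bar>x + y - c\<bar> < r + r" if "\<bar>x - c\<bar> \<le> r" "\<bar>y\<bar> < r" for x y r :: real
    using that by linarith
  from this[OF 2 3] have "\<bar>real_of_int j * \<theta> - of_int m - c\<bar> < 2 / of_int q"
    unfolding 1 by simp
  moreover have "real (nat j) = of_int j" using j by simp
  ultimately show thesis using that[of "nat j" m] j pq(2) by auto
qed

text \<open>A parameter interval of length \<open>\<delta>/2\<close> that belongs to the block \<open>w\<close> is hit by the orbit of any
  parameter within \<open>q\<close> steps, because the orbit comes within \<open>2/q \<le> \<delta>/4\<close> of its midpoint.\<close>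

lemma sturmian_recurrence:
  fixes \<theta> \<delta> :: real and p q :: int and Q :: nat
  assumes \<theta>: "0 < \<theta>" "\<theta> < 1" and \<delta>: "0 < \<delta>" "\<delta> \<le> 1"
    and sep: "\<And>k m :: int. 0 < \<bar>k\<bar> \<Longrightarrow> \<bar>k\<bar> \<le> int n \<Longrightarrow> \<delta> \<le> \<bar>of_int k * \<theta> - of_int m\<bar>"
    and pq: "coprime p q" "0 < q" "q \<le> int Q" "\<bar>of_int q * \<theta> - of_int p\<bar> < 1 / real Q"
    and large: "8 / \<delta> \<le> of_int q"
    and w: "w \<in> words (sturmian \<theta>) n" and z: "z \<in> sturmian \<theta>"
  shows "\<exists>j<nat q. (shift ^^ j) z \<in> cyl (sturmian \<theta>) w"
proof -
  interpret subshift "sturmian \<theta>" by (rule subshift_sturmian[OF \<theta>])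
  obtain y where y: "y \<in> sturmian \<theta>" "w = map y (window n)" using w unfolding words_window by blast
  define a where "a = 1 - int ((n + 1) div 2)"
  have win: "a \<le> i \<and> i < a + int n" if "i \<in> set (window n)" for i
    using that by (auto simp: window_shift a_def)
  obtain u where u: "\<And>t i. u < t \<Longrightarrow> t < u + \<delta> / 2 \<Longrightarrow> a \<le> i \<Longrightarrow> i < a + int n \<Longrightarrow>
      floor_word \<theta> t i = y i \<and> ceil_word \<theta> t i = y i"
    using block_interval[OF \<theta> \<delta> sep y(1), where a = a] by blast
  have "2 / of_int q \<le> \<delta> / 4" using large \<delta> pq(2) by (simp add: field_simps)
  then have hit: "\<exists>j m. j < nat q \<and> u < x - real j * \<theta> + of_int m \<and> x - real j * \<theta> + of_int m < u + \<delta> / 2" for x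
  proof -
    obtain j m where "j < nat q" "\<bar>real j * \<theta> - of_int m - (x - u - \<delta> / 4)\<bar> < 2 / of_int q"
      using orbit_dense[OF pq] by metis
    with \<open>2 / of_int q \<le> \<delta> / 4\<close> have "u < x - real j * \<theta> + of_int m" "x - real j * \<theta> + of_int m < u + \<delta> / 2"
      by linarith+
    with \<open>j < nat q\<close> show ?thesis by blast
  qed
  have zj: "(shift ^^ j) z \<in> sturmian \<theta>" for j using shift_power_X z by blast
  consider x where "z = floor_word \<theta> x" | x where "z = ceil_word \<theta> x"
    using z unfolding sturmian_eq[OF \<theta>] by blast
  then obtain j where j: "j < nat q" "\<And>i. a \<le> i \<Longrightarrow> i < a + int n \<Longrightarrow> (shift ^^ j) z i = y i"
  proof cases
    case (1 x)
    obtain j m where jm: "j < nat q" "u < x - real j * \<theta> + of_int m" "x - real j * \<theta> + of_int m < u + \<delta> / 2"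
      using hit by blast
    have "(shift ^^ j) z = floor_word \<theta> (x - real j * \<theta> + of_int m)"
      unfolding 1 shift_floor_word floor_word_int ..
    with u[OF jm(2,3)] jm(1) that show thesis by simp
  next
    case (2 x)
    obtain j m where jm: "j < nat q" "u < x - real j * \<theta> + of_int m" "x - real j * \<theta> + of_int m < u + \<delta> / 2"
      using hit by blast
    have "(shift ^^ j) z = ceil_word \<theta> (x - real j * \<theta> + of_int m)"
      unfolding 2 shift_ceil_word ceil_word_int ..
    with u[OF jm(2,3)] jm(1) that show thesis by simp
  qed
  have "(shift ^^ j) z \<in> cyl (sturmian \<theta>) w"
    unfolding y(2) cyl_map_window using zj j(2) win by (auto simp: same_def)
  with j(1) show ?thesis by blast
qed


section \<open>Diophantine approximation of almost every number\<close>

definition diophantine :: "real \<Rightarrow> real \<Rightarrow> bool" where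
  "diophantine \<tau> \<theta> \<longleftrightarrow> (\<exists>c>0. \<forall>k\<ge>1::nat. \<forall>m::int. c * real k powr (- \<tau>) \<le> \<bar>real k * \<theta> - of_int m\<bar>)"

text \<open>The exceptional set for \<open>k\<close> is covered by \<open>k + 1\<close> intervals of length \<open>2 * k powr (-\<tau> - 1)\<close>. Their
  total length is summable for \<open>\<tau> > 1\<close>, and the Borel-Cantelli lemma applies.\<close>

lemma AE_eventually_diophantine:
  assumes \<tau>: "\<tau> > 1"
  shows "AE \<theta> in lborel. \<forall>\<^sub>F k in sequentially.
    \<theta> \<notin> (\<Union>m\<in>{0..int k}. {of_int m / real k - real k powr (- \<tau> - 1) <..< of_int m / real k + real k powr (- \<tau> - 1)})"
    (is "AE \<theta> in lborel. \<forall>\<^sub>F k in sequentially. \<theta> \<notin> ?A k")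
proof -
  have le: "measure lborel (?A k) \<le> 4 * real k powr (- \<tau>)" and fin: "emeasure lborel (?A k) < \<infinity>" for k
  proof -
    define h where "h = real k powr (- \<tau> - 1)"
    have "emeasure lborel (?A k) \<le> (\<Sum>m\<in>{0..int k}. emeasure lborel {of_int m / real k - h <..< of_int m / real k + h})"
      unfolding h_def by (intro emeasure_subadditive_finite) auto
    also have "\<dots> = (\<Sum>m\<in>{0..int k}. ennreal (2 * h))" by (simp add: h_def)
    also have "\<dots> = ennreal (real (k + 1) * (2 * h))"
      by (simp add: ennreal_mult h_def ennreal_of_nat_eq_real_of_nat add.commute)
    finally have 1: "emeasure lborel (?A k) \<le> ennreal (real (k + 1) * (2 * h))" .
    then show "emeasure lborel (?A k) < \<infinity>" by (rule le_less_trans) simp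
    have "measure lborel (?A k) \<le> real (k + 1) * (2 * h)"
      using enn2real_mono[OF 1] by (simp add: measure_def h_def)
    also have "\<dots> \<le> 4 * real k powr (- \<tau>)"
    proof (cases "k = 0")
      case False
      then have "real (k + 1) * (2 * h) \<le> (2 * real k) * (2 * h)"
        by (intro mult_right_mono) (auto simp: h_def)
      also have "\<dots> = 4 * (real k powr 1 * real k powr (- \<tau> - 1))" using False by (simp add: h_def)
      also have "\<dots> = 4 * real k powr (- \<tau>)" unfolding powr_add[symmetric] by simp
      finally show ?thesis .
    qed (simp add: h_def)
    finally show "measure lborel (?A k) \<le> 4 * real k powr (- \<tau>)" .
  qed
  have "summable (\<lambda>k. 4 * real k powr (- \<tau>))"
    using \<tau> by (intro summable_mult) (simp add: summable_real_powr_iff)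
  then have "summable (\<lambda>k. measure lborel (?A k))"
    by (rule summable_comparison_test[rotated]) (use le in \<open>auto intro!: exI[of _ 0]\<close>)
  then have "AE \<theta> in lborel. \<forall>\<^sub>F k in sequentially. \<theta> \<in> space lborel - ?A k"
    using fin by (intro borel_cantelli_AE1) auto
  then show ?thesis by simp
qed

lemma irrational_distance:
  fixes \<theta> :: real
  assumes "\<theta> \<notin> \<rat>" "k \<ge> (1::nat)"
  shows "\<exists>c>0. \<forall>m::int. c \<le> \<bar>real k * \<theta> - of_int m\<bar>"
proof -
  define x where "x = real k * \<theta>"
  have "x \<notin> \<int>"
  proof
    assume "x \<in> \<int>"
    then have "x / real k \<in> \<rat>" using Ints_subset_Rats by (intro Rats_divide) auto
    then show False using assms by (simp add: x_def)
  qed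
  then have "of_int \<lfloor>x\<rfloor> \<noteq> x" by (metis Ints_of_int)
  then have "of_int \<lfloor>x\<rfloor> < x" using floor_correct[of x] by linarith
  then have "frac x > 0" "1 - frac x > 0" using frac_lt_1[of x] by (simp_all add: frac_def)
  moreover have "min (frac x) (1 - frac x) \<le> \<bar>x - of_int m\<bar>" for m :: int
  proof (cases "m \<le> \<lfloor>x\<rfloor>")
    case True
    then have "real_of_int m \<le> of_int \<lfloor>x\<rfloor>" by simp
    then have "frac x \<le> \<bar>x - of_int m\<bar>" unfolding frac_def by linarith
    then show ?thesis by (rule min.coboundedI1)
  next
    case False
    then have "real_of_int m \<ge> of_int \<lfloor>x\<rfloor> + 1" by linarith
    then have "1 - frac x \<le> \<bar>x - of_int m\<bar>" unfolding frac_def by linarith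
    then show ?thesis by (rule min.coboundedI2)
  qed
  ultimately show ?thesis unfolding x_def[symmetric]
    by (intro exI[of _ "min (frac x) (1 - frac x)"]) auto
qed

text \<open>The preceding lemma excludes good approximations with large denominators; the finitely many
  small ones only affect the constant, as \<open>\<theta>\<close> is irrational.\<close>

lemma AE_diophantine:
  assumes \<tau>: "\<tau> > 1"
  shows "AE \<theta> in lebesgue_on {0<..<1::real}. \<theta> \<notin> \<rat> \<longrightarrow> diophantine \<tau> \<theta>"
proof -
  let ?A = "\<lambda>k. \<Union>m\<in>{0..int k}. {of_int m / real k - real k powr (- \<tau> - 1) <..< of_int m / real k + real k powr (- \<tau> - 1)}"
  have "diophantine \<tau> \<theta>" if \<theta>: "\<theta> \<in> {0<..<1}" "\<theta> \<notin> \<rat>" and ev: "\<forall>\<^sub>F k in sequentially. \<theta> \<notin> ?A k" for \<theta>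
  proof -
    obtain N where N: "\<And>k. k \<ge> N \<Longrightarrow> \<theta> \<notin> ?A k" using ev by (auto simp: eventually_sequentially)
    obtain c where c: "\<And>k. k \<ge> (1::nat) \<Longrightarrow> c k > 0" "\<And>k m. k \<ge> 1 \<Longrightarrow> c k \<le> \<bar>real k * \<theta> - of_int m\<bar>"
      using irrational_distance[OF \<theta>(2)] by metis
    define d where "d = Min (insert 1 (c ` {1..<N}))"
    have d0: "d > 0" unfolding d_def using c(1) by (subst Min_gr_iff) auto
    have d1: "d \<le> 1" unfolding d_def by (rule Min_le) auto
    have dc: "d \<le> c k" if "k \<in> {1..<N}" for k
      unfolding d_def using that by (intro Min_le) auto
    have "d * real k powr (- \<tau>) \<le> \<bar>real k * \<theta> - of_int m\<bar>" if k: "k \<ge> 1" for k m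
    proof -
      have p1: "real k powr (- \<tau>) \<le> 1"
        using k \<tau> by (simp add: powr_le_one_le powr_minus inverse_le_1_iff ge_one_powr_ge_zero)
      show ?thesis
      proof (cases "k < N")
        case True
        have "d * real k powr (- \<tau>) \<le> d * 1" using p1 d0 by (intro mult_left_mono) auto
        also have "\<dots> \<le> c k" using dc True k by simp
        also have "\<dots> \<le> \<bar>real k * \<theta> - of_int m\<bar>" by (rule c(2)[OF k])
        finally show ?thesis .
      next
        case False
        have "real k powr (- \<tau>) \<le> \<bar>real k * \<theta> - of_int m\<bar>"
        proof (rule ccontr)
          assume "\<not> ?thesis"
          then have lt: "\<bar>real k * \<theta> - of_int m\<bar> < real k powr (- \<tau>)" by simp
          have k0: "real k > 0" using k by simp
          have "0 < real k * \<theta>" "real k * \<theta> < real k" using \<theta> k0 by auto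
          then have "- 1 < real_of_int m" "real_of_int m < real k + 1" using lt p1 by linarith+
          then have m: "m \<in> {0..int k}" by (auto; linarith)
          have "\<bar>\<theta> - of_int m / real k\<bar> = \<bar>real k * \<theta> - of_int m\<bar> / real k"
            using k0 by (simp add: abs_divide[symmetric] field_simps)
          also have "\<dots> < real k powr (- \<tau>) / real k" using lt k0 by (rule divide_strict_right_mono)
          also have "\<dots> = real k powr (- \<tau> - 1)" using k0 by (simp add: powr_diff)
          finally have "\<theta> \<in> ?A k" using m by (intro UN_I[of m]) (auto simp: abs_less_iff)
          moreover have "\<theta> \<notin> ?A k" using False by (intro N) simp
          ultimately show False by contradiction
        qed
        moreover have "d * real k powr (- \<tau>) \<le> 1 * real k powr (- \<tau>)"
          using d1 by (intro mult_right_mono) auto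
        ultimately show ?thesis by simp
      qed
    qed
    with d0 show ?thesis unfolding diophantine_def by blast
  qed
  with AE_eventually_diophantine[OF \<tau>]
  have "AE \<theta> in lborel. \<theta> \<in> {0<..<1} \<longrightarrow> \<theta> \<notin> \<rat> \<longrightarrow> diophantine \<tau> \<theta>"
    by (auto elim!: AE_mp)
  then have "AE \<theta> in lebesgue. \<theta> \<in> {0<..<1} \<longrightarrow> \<theta> \<notin> \<rat> \<longrightarrow> diophantine \<tau> \<theta>"
    by (rule AE_completion)
  then show ?thesis by (subst AE_restrict_space_iff) auto
qed

section \<open>The Connes metric of Sturmian subshifts\<close>

text \<open>The diophantine condition is used twice. It bounds from below the distances \<open>\<delta>\<close> of the points that
  separate the blocks of length \<open>n\<close>, by a multiple of \<open>n powr (-5/4)\<close>. And it shows that the denominator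
  \<open>q \<le> Q\<close> given by Dirichlet's theorem cannot be much smaller than \<open>Q\<close>: it exceeds \<open>K = 8/\<delta>\<close> if \<open>Q\<close> is
  a suitable multiple of \<open>K powr (5/4)\<close>. Every word then meets every cylinder of length \<open>n\<close> within
  \<open>Q\<close> steps, and \<open>Q\<close> is at most a multiple of \<open>n powr (25/16)\<close>.\<close>

lemma sturmian_measure_lower:
  assumes \<theta>: "0 < \<theta>" "\<theta> < 1" and dio: "diophantine (5/4) \<theta>"
  obtains C where "C > 0"
    "\<And>\<mu> n w. invariant_prob (sturmian \<theta>) \<mu> \<Longrightarrow> n \<ge> 1 \<Longrightarrow> w \<in> words (sturmian \<theta>) n \<Longrightarrow>
      C * real n powr (- (25/16)) \<le> measure \<mu> (cyl (sturmian \<theta>) w)"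
proof -
  obtain c0 where c0: "c0 > 0" "\<And>k m. k \<ge> (1::nat) \<Longrightarrow> c0 * real k powr (- (5/4)) \<le> \<bar>real k * \<theta> - of_int m\<bar>"
    using dio unfolding diophantine_def by blast
  define c where "c = min c0 1"
  have c: "c > 0" "c \<le> 1" using c0(1) by (auto simp: c_def)
  have dist: "c * real k powr (- (5/4)) \<le> \<bar>real k * \<theta> - of_int m\<bar>" if "k \<ge> 1" for k m
    using order_trans[OF mult_right_mono c0(2)[OF that], of c] by (simp add: c_def)
  define C where "C = c / (2 * (8 / c) powr (5/4))"
  have C: "C > 0" using c by (simp add: C_def)
  have "C * real n powr (- (25/16)) \<le> measure \<mu> (cyl (sturmian \<theta>) w)"
    if inv: "invariant_prob (sturmian \<theta>) \<mu>" and n: "n \<ge> 1" and w: "w \<in> words (sturmian \<theta>) n" for \<mu> n w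
  proof -
    interpret invariant_subshift "sturmian \<theta>" \<mu>
      using subshift_sturmian[OF \<theta>] inv by (simp add: invariant_subshift_def invariant_subshift_axioms_def)
    define \<delta> where "\<delta> = c * real n powr (- (5/4))"
    have n1: "real n \<ge> 1" using n by simp
    have "real n powr (- (5/4)) \<le> 1" using n1 by (simp add: powr_minus inverse_le_1_iff ge_one_powr_ge_zero)
    then have \<delta>: "0 < \<delta>" "\<delta> \<le> 1"
      using c n1 mult_mono[of c 1 "real n powr (- (5/4))" 1] by (auto simp: \<delta>_def)
    have sep: "\<delta> \<le> \<bar>of_int k * \<theta> - of_int m\<bar>" if k: "0 < \<bar>k\<bar>" "\<bar>k\<bar> \<le> int n" for k m :: int
    proof -
      define k' where "k' = nat \<bar>k\<bar>"
      have k': "k' \<ge> 1" "k' \<le> n" "real k' = \<bar>real_of_int k\<bar>" using k by (auto simp: k'_def)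
      have "\<delta> \<le> c * real k' powr (- (5/4))"
        unfolding \<delta>_def using k' c by (intro mult_left_mono powr_mono2') auto
      also have "\<dots> \<le> \<bar>real k' * \<theta> - of_int (sgn k * m)\<bar>" by (rule dist[OF k'(1)])
      also have "\<dots> = \<bar>of_int k * \<theta> - of_int m\<bar>"
        using k(1) unfolding k'(3) by (cases "k > 0") (auto simp: abs_if)
      finally show ?thesis .
    qed
    define K where "K = 8 / \<delta>"
    have K: "K \<ge> 8" using \<delta> by (simp add: K_def field_simps)
    define Q where "Q = nat \<lceil>K powr (5/4) / c\<rceil>"
    have Kp: "K powr (5/4) \<ge> 1" using K by (intro ge_one_powr_ge_zero) auto
    then have Kc: "1 \<le> K powr (5/4) / c" using c by (simp add: field_simps)
    have Q: "K powr (5/4) / c \<le> real Q" "real Q \<le> K powr (5/4) / c + 1"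
      using Kc unfolding Q_def by linarith+
    have Q0: "Q > 0" using Q(1) Kc by linarith
    obtain p q where pq: "coprime p q" "0 < q" "q \<le> int Q" "\<bar>of_int q * \<theta> - of_int p\<bar> < 1 / real Q"
      using Dirichlet_approx_coprime[OF Q0] by blast
    have q: "real (nat q) = of_int q" "nat q \<ge> 1" using pq(2) by auto
    have large: "8 / \<delta> \<le> of_int q"
    proof -
      have "c * of_int q powr (- (5/4)) \<le> \<bar>of_int q * \<theta> - of_int p\<bar>"
        using dist[OF q(2), of p] q(1) by simp
      also note pq(4)
      also have "1 / real Q \<le> c / K powr (5/4)"
        using divide_left_mono[OF Q(1), of 1] Kc Q0 c order.strict_trans2[OF zero_less_one Kp] by simp
      finally have "c * of_int q powr (- (5/4)) < c * (1 / K powr (5/4))" by simp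
      then have "of_int q powr (- (5/4)) < 1 / K powr (5/4)"
        using mult_less_cancel_left_pos[OF c(1)] by blast
      then have "K powr (5/4) < of_int q powr (5/4)"
        using pq(2) Kp order.strict_trans2[OF zero_less_one Kp] by (simp add: powr_minus field_simps)
      then have "K < of_int q"
        using powr_mono2[of "5/4" "of_int q" K] pq(2) by (auto simp: not_less[symmetric])
      then show ?thesis by (simp add: K_def)
    qed
    have "1 \<le> real (nat q) * measure \<mu> (cyl (sturmian \<theta>) w)"
      by (rule measure_recurrent[OF sets_cyl sturmian_recurrence[OF \<theta> \<delta> sep pq large w]])
    also have "\<dots> \<le> real Q * measure \<mu> (cyl (sturmian \<theta>) w)"
      using pq(3) by (intro mult_right_mono) auto
    also have "\<dots> \<le> (2 * K powr (5/4) / c) * measure \<mu> (cyl (sturmian \<theta>) w)"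
      using Q(2) Kc by (intro mult_right_mono) auto
    finally have "c / (2 * K powr (5/4)) \<le> measure \<mu> (cyl (sturmian \<theta>) w)"
      using c order.strict_trans2[OF zero_less_one Kp] by (simp add: field_simps)
    moreover have "K powr (5/4) = (8 / c) powr (5/4) * real n powr (25/16)"
    proof -
      have "K = 8 / c * real n powr (5/4)"
        using c n1 by (simp add: K_def \<delta>_def powr_minus field_simps)
      then have "K powr (5/4) = (8 / c) powr (5/4) * (real n powr (5/4)) powr (5/4)"
        using c by (simp only: powr_mult)
      then show ?thesis by (simp add: powr_powr)
    qed
    moreover have "C * real n powr (- (25/16)) = c / (2 * ((8 / c) powr (5/4) * real n powr (25/16)))"
      unfolding C_def powr_minus divide_inverse[symmetric] by (simp only: divide_divide_eq_left mult.assoc)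
    ultimately show ?thesis by (simp only:)
  qed
  with C that show thesis by blast
qed

theorem corollary5p15:
  "AE \<theta> in lebesgue_on {0<..<1::real}. \<theta> \<notin> \<rat> \<longrightarrow>
     (\<forall>\<mu>. invariant_prob (sturmian \<theta>) \<mu> \<longrightarrow>
        finite_connes_metric (sturmian \<theta>) \<mu> \<and>
        connes_topology (sturmian \<theta>) \<mu> = weak_star (sturmian \<theta>))"
proof -
  have *: "finite_connes_metric (sturmian \<theta>) \<mu> \<and> connes_topology (sturmian \<theta>) \<mu> = weak_star (sturmian \<theta>)"
    if \<theta>: "0 < \<theta>" "\<theta> < 1" "diophantine (5/4) \<theta>" and inv: "invariant_prob (sturmian \<theta>) \<mu>" for \<theta> \<mu>
  proof -
    obtain C where C: "C > 0" "\<And>n w. n \<ge> 1 \<Longrightarrow> w \<in> words (sturmian \<theta>) n \<Longrightarrow>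
        C * real n powr (- (25/16)) \<le> measure \<mu> (cyl (sturmian \<theta>) w)"
      using sturmian_measure_lower[OF \<theta>] inv by metis
    interpret invariant_subshift "sturmian \<theta>" \<mu>
      using subshift_sturmian[OF \<theta>(1,2)] inv by (simp add: invariant_subshift_def invariant_subshift_axioms_def)
    interpret polynomial_subshift "sturmian \<theta>" \<mu> C "25/16"
    proof unfold_locales
      fix w n assume w: "w \<in> words (sturmian \<theta>) n"
      show "measure \<mu> (cyl (sturmian \<theta>) w) > 0"
      proof (cases "n = 0")
        case True
        with w have "cyl (sturmian \<theta>) w = sturmian \<theta>" by (simp add: words_0) (simp add: cyl_def window_def)
        then show ?thesis by (simp add: measure_X)
      next
        case False
        then have "0 < C * real n powr (- (25/16))" using C(1) by simp
        also have "\<dots> \<le> measure \<mu> (cyl (sturmian \<theta>) w)" using C(2) w False by simp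
        finally show ?thesis .
      qed
    qed (use C in auto)
    show ?thesis using finite_metric connes_topology_eq_weak_star by blast
  qed
  have "AE \<theta> in lebesgue_on {0<..<1::real}. \<theta> \<notin> \<rat> \<longrightarrow> diophantine (5/4) \<theta>"
    by (rule AE_diophantine) simp
  moreover have "AE \<theta> in lebesgue_on {0<..<1::real}. \<theta> \<in> space (lebesgue_on {0<..<1})"
    by (rule AE_space)
  ultimately show ?thesis by eventually_elim (use * in simp)
qed

end
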